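(* Let $I$ be the pullback shape category $\{\bullet\to\bullet\leftarrow\bullet\}$. Let $\mathcal{A}$ be the $2$-category generated by objects $X,L,A,B,C$; morphisms $f,g\colon X\to L$, $\lambda_0\colon L\to B$, $\lambda_1\colon L\to C$, $b\colon B\to A$, $c\colon C\to A$; and a $2$-morphism $\alpha\colon f\Rightarrow g$; subject to the relation $b\lambda_0=c\lambda_1$. Let $F\colon I\to\mathcal{A}$ be the diagram $B\xrightarrow{b}A\xleftarrow{c}C$, and let $\lambda\colon\Delta L\Rightarrow F$ be the cone with components $\lambda_0$ at $B$, $\lambda_1$ at $C$ and $b\lambda_0=c\lambda_1$ at $A$ (with identity $2$-morphism components). Then $(L,\lambda)$ is a pseudo-limit of $F$ that is not $2$-terminal in the lax-slice of pseudo-cones over $F$.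
   Context: $2$-categories and $2$-functors are strict; $*$ denotes horizontal composition (and whiskering) of $2$-morphisms and juxtaposition denotes vertical composition. "Generated by the data subject to relations" means the $2$-category freely generated by the listed objects, morphisms and $2$-morphisms, modulo the listed relations. The $1$-category $I$ is regarded as a $2$-category with only identity $2$-morphisms. A pseudo-natural transformation $\mu\colon F\Rightarrow G$ between $2$-functors $F,G\colon I\to\mathcal{A}$ consists of morphisms $\mu_i\colon Fi\to Gi$ for $i\in I$ and invertible $2$-morphisms $\mu_f\colon(Gf)\mu_i\Rightarrow\mu_j(Ff)$ for $f\colon i\to j$ in $I$, such that $\mu_{\mathrm{id}_i}=\mathrm{id}_{\mu_i}$, $\mu_{gf}=(\mu_g*Ff)(Gg*\mu_f)$ for composable $f,g$, and $\mu_g(G\alpha*\mu_i)=(\mu_j*F\alpha)\mu_f$ for every $2$-morphism $\alpha\colon f\Rightarrow g$ in $I$. A modification $\varphi\colon\mu\to\nu$ consists of $2$-morphisms $\varphi_i\colon\mu_i\Rightarrow\nu_i$ with $\nu_f(Gf*\varphi_i)=(\varphi_j*Ff)\mu_f$ for every $f\colon i\to j$. $\mathrm{Ps}[I,\mathcal{A}]$ is the $2$-category of $2$-functors, pseudo-natural transformations and modifications. $\Delta X$ is the constant $2$-functor at $X$; a pseudo-cone over $F$ is a pseudo-natural transformation $\Delta X\Rightarrow F$. A pseudo-limit of $F$ is a pair $(L,\lambda\colon\Delta L\Rightarrow F)$ with $\lambda$ a pseudo-cone such that for each $X\in\mathcal{A}$ the functor $\lambda_*\circ\Delta\colon\mathcal{A}(X,L)\to\mathrm{Ps}[I,\mathcal{A}](\Delta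 X,F)$, given by post-composition with $\lambda$, is an isomorphism of categories. The lax-slice of pseudo-cones over $F$ is the $2$-category whose objects are pairs $(X,\mu)$ with $\mu\colon\Delta X\Rightarrow F$ a pseudo-cone; morphisms $(X,\mu)\to(Y,\nu)$ are pairs $(f,\varphi)$ of a morphism $f\colon X\to Y$ in $\mathcal{A}$ and a modification $\varphi\colon\nu\Delta f\to\mu$; $2$-morphisms $(f,\varphi)\Rightarrow(g,\psi)$ are $2$-morphisms $\alpha\colon f\Rightarrow g$ in $\mathcal{A}$ with $\psi(\nu*\Delta\alpha)=\varphi$. An object $L$ of a $2$-category $\mathcal{B}$ is $2$-terminal if for all $X\in\mathcal{B}$ the category $\mathcal{B}(X,L)$ is isomorphic to the terminal category $\mathbb{1}$. *)

theory Defs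
  imports "HOL-Library.FuncSet"
begin

section \<open>Categories\<close>

record ('o, 'a) cat =
  Obj :: "'o set"
  Arr :: "'a set"
  cdom :: "'a \<Rightarrow> 'o"
  ccod :: "'a \<Rightarrow> 'o"
  cid :: "'o \<Rightarrow> 'a"
  ccomp :: "'a \<Rightarrow> 'a \<Rightarrow> 'a"

locale category =
  fixes C :: "('o, 'a) cat"
  assumes dom_ob: "u \<in> Arr C \<Longrightarrow> cdom C u \<in> Obj C"
    and cod_ob: "u \<in> Arr C \<Longrightarrow> ccod C u \<in> Obj C"
    and id_arr: "x \<in> Obj C \<Longrightarrow>
      cid C x \<in> Arr C \<and> cdom C (cid C x) = x \<and> ccod C (cid C x) = x"
    and comp_arr: "\<lbrakk>u \<in> Arr C; v \<in> Arr C; ccod C u = cdom C v\<rbrakk> \<Longrightarrow>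
      ccomp C v u \<in> Arr C \<and> cdom C (ccomp C v u) = cdom C u \<and> ccod C (ccomp C v u) = ccod C v"
    and comp_id_left: "u \<in> Arr C \<Longrightarrow> ccomp C (cid C (ccod C u)) u = u"
    and comp_id_right: "u \<in> Arr C \<Longrightarrow> ccomp C u (cid C (cdom C u)) = u"
    and comp_assoc: "\<lbrakk>u \<in> Arr C; v \<in> Arr C; w \<in> Arr C; ccod C u = cdom C v; ccod C v = cdom C w\<rbrakk> \<Longrightarrow>
      ccomp C w (ccomp C v u) = ccomp C (ccomp C w v) u"

record ('o, 'a, 'p, 'b) cfun =
  cfob :: "'o \<Rightarrow> 'p"
  cfarr :: "'a \<Rightarrow> 'b"

locale is_functor = source: category C + target: category D
  for C :: "('o, 'a) cat" and D :: "('p, 'b) cat" +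
  fixes F :: "('o, 'a, 'p, 'b) cfun"
  assumes ob: "x \<in> Obj C \<Longrightarrow> cfob F x \<in> Obj D"
    and arr: "u \<in> Arr C \<Longrightarrow> cfarr F u \<in> Arr D \<and>
      cdom D (cfarr F u) = cfob F (cdom C u) \<and> ccod D (cfarr F u) = cfob F (ccod C u)"
    and id: "x \<in> Obj C \<Longrightarrow> cfarr F (cid C x) = cid D (cfob F x)"
    and comp: "\<lbrakk>u \<in> Arr C; v \<in> Arr C; ccod C u = cdom C v\<rbrakk> \<Longrightarrow>
      cfarr F (ccomp C v u) = ccomp D (cfarr F v) (cfarr F u)"

definition cat_iso :: "('o, 'a) cat \<Rightarrow> ('p, 'b) cat \<Rightarrow> ('o, 'a, 'p, 'b) cfun \<Rightarrow> bool" where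
  "cat_iso C D F \<longleftrightarrow> is_functor C D F \<and>
     (\<exists>G. is_functor D C G \<and>
       (\<forall>x\<in>Obj C. cfob G (cfob F x) = x) \<and> (\<forall>u\<in>Arr C. cfarr G (cfarr F u) = u) \<and>
       (\<forall>y\<in>Obj D. cfob F (cfob G y) = y) \<and> (\<forall>v\<in>Arr D. cfarr F (cfarr G v) = v))"

definition isomorphic_cats :: "('o, 'a) cat \<Rightarrow> ('p, 'b) cat \<Rightarrow> bool" where
  "isomorphic_cats C D \<longleftrightarrow> (\<exists>F. cat_iso C D F)"

definition terminal_cat :: "(unit, unit) cat" where
  "terminal_cat = \<lparr>Obj = {()}, Arr = {()}, cdom = (\<lambda>_. ()), ccod = (\<lambda>_. ()),
     cid = (\<lambda>_. ()), ccomp = (\<lambda>_ _. ())\<rparr>"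


section \<open>Strict 2-categories and 2-functors\<close>

record ('o, 'm, 'c) two_cat =
  Ob :: "'o set"
  Mor :: "'m set"
  Cell :: "'c set"
  src :: "'m \<Rightarrow> 'o"
  tgt :: "'m \<Rightarrow> 'o"
  dom2 :: "'c \<Rightarrow> 'm"
  cod2 :: "'c \<Rightarrow> 'm"
  id1 :: "'o \<Rightarrow> 'm"
  comp1 :: "'m \<Rightarrow> 'm \<Rightarrow> 'm"  (infixr "\<odot>\<index>" 75)
  id2 :: "'m \<Rightarrow> 'c"
  vcomp :: "'c \<Rightarrow> 'c \<Rightarrow> 'c"  (infixr "\<cdot>\<index>" 70)
  hcomp :: "'c \<Rightarrow> 'c \<Rightarrow> 'c"  (infixr "\<star>\<index>" 75)

text \<open>All compositions are written in applicative order: the right-hand argument comes first.\<close>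

locale two_category =
  fixes A :: "('o, 'm, 'c) two_cat" (structure)
  assumes mor_typed: "f \<in> Mor A \<Longrightarrow> src A f \<in> Ob A \<and> tgt A f \<in> Ob A"
    and id1_typed: "X \<in> Ob A \<Longrightarrow> id1 A X \<in> Mor A \<and> src A (id1 A X) = X \<and> tgt A (id1 A X) = X"
    and comp1_typed: "\<lbrakk>f \<in> Mor A; g \<in> Mor A; tgt A f = src A g\<rbrakk> \<Longrightarrow>
      g \<odot> f \<in> Mor A \<and> src A (g \<odot> f) = src A f \<and> tgt A (g \<odot> f) = tgt A g"
    and comp1_id_left: "f \<in> Mor A \<Longrightarrow> id1 A (tgt A f) \<odot> f = f"
    and comp1_id_right: "f \<in> Mor A \<Longrightarrow> f \<odot> id1 A (src A f) = f"
    and comp1_assoc: "\<lbrakk>f \<in> Mor A; g \<in> Mor A; h \<in> Mor A; tgt A f = src A g; tgt A g = src A h\<rbrakk> \<Longrightarrow>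
      h \<odot> (g \<odot> f) = (h \<odot> g) \<odot> f"
    and cell_typed: "a \<in> Cell A \<Longrightarrow> dom2 A a \<in> Mor A \<and> cod2 A a \<in> Mor A \<and>
      src A (dom2 A a) = src A (cod2 A a) \<and> tgt A (dom2 A a) = tgt A (cod2 A a)"
    and id2_typed: "f \<in> Mor A \<Longrightarrow> id2 A f \<in> Cell A \<and> dom2 A (id2 A f) = f \<and> cod2 A (id2 A f) = f"
    and vcomp_typed: "\<lbrakk>a \<in> Cell A; b \<in> Cell A; cod2 A a = dom2 A b\<rbrakk> \<Longrightarrow>
      b \<cdot> a \<in> Cell A \<and> dom2 A (b \<cdot> a) = dom2 A a \<and> cod2 A (b \<cdot> a) = cod2 A b"
    and vcomp_id_left: "a \<in> Cell A \<Longrightarrow> id2 A (cod2 A a) \<cdot> a = a"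
    and vcomp_id_right: "a \<in> Cell A \<Longrightarrow> a \<cdot> id2 A (dom2 A a) = a"
    and vcomp_assoc: "\<lbrakk>a \<in> Cell A; b \<in> Cell A; c \<in> Cell A; cod2 A a = dom2 A b; cod2 A b = dom2 A c\<rbrakk> \<Longrightarrow>
      c \<cdot> (b \<cdot> a) = (c \<cdot> b) \<cdot> a"
    and hcomp_typed: "\<lbrakk>a \<in> Cell A; b \<in> Cell A; tgt A (dom2 A a) = src A (dom2 A b)\<rbrakk> \<Longrightarrow>
      b \<star> a \<in> Cell A \<and> dom2 A (b \<star> a) = dom2 A b \<odot> dom2 A a \<and> cod2 A (b \<star> a) = cod2 A b \<odot> cod2 A a"
    and hcomp_id_left: "a \<in> Cell A \<Longrightarrow> id2 A (id1 A (tgt A (dom2 A a))) \<star> a = a"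
    and hcomp_id_right: "a \<in> Cell A \<Longrightarrow> a \<star> id2 A (id1 A (src A (dom2 A a))) = a"
    and hcomp_assoc: "\<lbrakk>a \<in> Cell A; b \<in> Cell A; c \<in> Cell A;
        tgt A (dom2 A a) = src A (dom2 A b); tgt A (dom2 A b) = src A (dom2 A c)\<rbrakk> \<Longrightarrow>
      c \<star> (b \<star> a) = (c \<star> b) \<star> a"
    and hcomp_id2: "\<lbrakk>f \<in> Mor A; g \<in> Mor A; tgt A f = src A g\<rbrakk> \<Longrightarrow>
      id2 A g \<star> id2 A f = id2 A (g \<odot> f)"
    and interchange: "\<lbrakk>a \<in> Cell A; b \<in> Cell A; c \<in> Cell A; d \<in> Cell A;
        cod2 A a = dom2 A b; cod2 A c = dom2 A d; tgt A (dom2 A a) = src A (dom2 A c)\<rbrakk> \<Longrightarrow>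
      (d \<cdot> c) \<star> (b \<cdot> a) = (d \<star> b) \<cdot> (c \<star> a)"

definition hom_cat :: "('o, 'm, 'c) two_cat \<Rightarrow> 'o \<Rightarrow> 'o \<Rightarrow> ('m, 'c) cat" where
  "hom_cat A X Y = \<lparr>
     Obj = {f \<in> Mor A. src A f = X \<and> tgt A f = Y},
     Arr = {a \<in> Cell A. src A (dom2 A a) = X \<and> tgt A (dom2 A a) = Y},
     cdom = dom2 A, ccod = cod2 A, cid = id2 A, ccomp = vcomp A\<rparr>"

definition invertible2 :: "('o, 'm, 'c) two_cat \<Rightarrow> 'c \<Rightarrow> bool" where
  "invertible2 A a \<longleftrightarrow> a \<in> Cell A \<and>
     (\<exists>b\<in>Cell A. dom2 A b = cod2 A a \<and> cod2 A b = dom2 A a \<and>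
        b \<cdot>\<^bsub>A\<^esub> a = id2 A (dom2 A a) \<and> a \<cdot>\<^bsub>A\<^esub> b = id2 A (cod2 A a))"

definition locally_discrete :: "('o, 'm) cat \<Rightarrow> ('o, 'm, 'm) two_cat" where
  "locally_discrete C = \<lparr>
     Ob = Obj C, Mor = Arr C, Cell = Arr C, src = cdom C, tgt = ccod C,
     dom2 = (\<lambda>f. f), cod2 = (\<lambda>f. f), id1 = cid C, comp1 = ccomp C,
     id2 = (\<lambda>f. f), vcomp = (\<lambda>g f. f), hcomp = ccomp C\<rparr>"

record ('i, 'u, 's, 'o, 'm, 'c) tfun =
  fob :: "'i \<Rightarrow> 'o"
  fmor :: "'u \<Rightarrow> 'm"
  fcell :: "'s \<Rightarrow> 'c"

text \<open>Families indexed by the objects, morphisms or 2-morphisms of a 2-category are required to be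
  extensional, so that equality in HOL coincides with equality of the family.\<close>

locale two_functor = source: two_category I + target: two_category A
  for I :: "('i, 'u, 's) two_cat" and A :: "('o, 'm, 'c) two_cat" +
  fixes F :: "('i, 'u, 's, 'o, 'm, 'c) tfun"
  assumes ext: "fob F \<in> extensional (Ob I)" "fmor F \<in> extensional (Mor I)"
      "fcell F \<in> extensional (Cell I)"
    and ob: "i \<in> Ob I \<Longrightarrow> fob F i \<in> Ob A"
    and mor: "u \<in> Mor I \<Longrightarrow> fmor F u \<in> Mor A \<and>
      src A (fmor F u) = fob F (src I u) \<and> tgt A (fmor F u) = fob F (tgt I u)"
    and cell: "s \<in> Cell I \<Longrightarrow> fcell F s \<in> Cell A \<and>
      dom2 A (fcell F s) = fmor F (dom2 I s) \<and> cod2 A (fcell F s) = fmor F (cod2 I s)"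
    and id1: "i \<in> Ob I \<Longrightarrow> fmor F (id1 I i) = id1 A (fob F i)"
    and comp1: "\<lbrakk>u \<in> Mor I; v \<in> Mor I; tgt I u = src I v\<rbrakk> \<Longrightarrow>
      fmor F (v \<odot>\<^bsub>I\<^esub> u) = fmor F v \<odot>\<^bsub>A\<^esub> fmor F u"
    and id2: "u \<in> Mor I \<Longrightarrow> fcell F (id2 I u) = id2 A (fmor F u)"
    and vcomp: "\<lbrakk>s \<in> Cell I; t \<in> Cell I; cod2 I s = dom2 I t\<rbrakk> \<Longrightarrow>
      fcell F (t \<cdot>\<^bsub>I\<^esub> s) = fcell F t \<cdot>\<^bsub>A\<^esub> fcell F s"
    and hcomp: "\<lbrakk>s \<in> Cell I; t \<in> Cell I; tgt I (dom2 I s) = src I (dom2 I t)\<rbrakk> \<Longrightarrow>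
      fcell F (t \<star>\<^bsub>I\<^esub> s) = fcell F t \<star>\<^bsub>A\<^esub> fcell F s"


section \<open>Pseudo-natural transformations, modifications and \<open>Ps[I,A]\<close>\<close>

record ('i, 'u, 's, 'o, 'm, 'c) psnat =
  psrc :: "('i, 'u, 's, 'o, 'm, 'c) tfun"
  ptgt :: "('i, 'u, 's, 'o, 'm, 'c) tfun"
  pob :: "'i \<Rightarrow> 'm"
  pmor :: "'u \<Rightarrow> 'c"

record ('i, 'u, 's, 'o, 'm, 'c) modif =
  mdom :: "('i, 'u, 's, 'o, 'm, 'c) psnat"
  mcod :: "('i, 'u, 's, 'o, 'm, 'c) psnat"
  mob :: "'i \<Rightarrow> 'c"

locale pseudo_nat =
  source: two_functor I A "psrc \<mu>" + target: two_functor I A "ptgt \<mu>"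
  for I :: "('i, 'u, 's) two_cat" and A :: "('o, 'm, 'c) two_cat"
    and \<mu> :: "('i, 'u, 's, 'o, 'm, 'c) psnat" +
  assumes ext: "pob \<mu> \<in> extensional (Ob I)" "pmor \<mu> \<in> extensional (Mor I)"
    and ob: "i \<in> Ob I \<Longrightarrow> pob \<mu> i \<in> Mor A \<and>
      src A (pob \<mu> i) = fob (psrc \<mu>) i \<and> tgt A (pob \<mu> i) = fob (ptgt \<mu>) i"
    and mor: "u \<in> Mor I \<Longrightarrow> invertible2 A (pmor \<mu> u) \<and>
      dom2 A (pmor \<mu> u) = fmor (ptgt \<mu>) u \<odot>\<^bsub>A\<^esub> pob \<mu> (src I u) \<and>
      cod2 A (pmor \<mu> u) = pob \<mu> (tgt I u) \<odot>\<^bsub>A\<^esub> fmor (psrc \<mu>) u"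
    and id: "i \<in> Ob I \<Longrightarrow> pmor \<mu> (id1 I i) = id2 A (pob \<mu> i)"
    and comp: "\<lbrakk>u \<in> Mor I; v \<in> Mor I; tgt I u = src I v\<rbrakk> \<Longrightarrow>
      pmor \<mu> (v \<odot>\<^bsub>I\<^esub> u) =
        (pmor \<mu> v \<star>\<^bsub>A\<^esub> id2 A (fmor (psrc \<mu>) u)) \<cdot>\<^bsub>A\<^esub> (id2 A (fmor (ptgt \<mu>) v) \<star>\<^bsub>A\<^esub> pmor \<mu> u)"
    and natural: "s \<in> Cell I \<Longrightarrow>
      pmor \<mu> (cod2 I s) \<cdot>\<^bsub>A\<^esub> (fcell (ptgt \<mu>) s \<star>\<^bsub>A\<^esub> id2 A (pob \<mu> (src I (dom2 I s)))) =
      (id2 A (pob \<mu> (tgt I (dom2 I s))) \<star>\<^bsub>A\<^esub> fcell (psrc \<mu>) s) \<cdot>\<^bsub>A\<^esub> pmor \<mu> (dom2 I s)"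

locale modification =
  source: pseudo_nat I A "mdom \<phi>" + target: pseudo_nat I A "mcod \<phi>"
  for I :: "('i, 'u, 's) two_cat" and A :: "('o, 'm, 'c) two_cat"
    and \<phi> :: "('i, 'u, 's, 'o, 'm, 'c) modif" +
  assumes parallel: "psrc (mdom \<phi>) = psrc (mcod \<phi>)" "ptgt (mdom \<phi>) = ptgt (mcod \<phi>)"
    and ext: "mob \<phi> \<in> extensional (Ob I)"
    and ob: "i \<in> Ob I \<Longrightarrow> mob \<phi> i \<in> Cell A \<and>
      dom2 A (mob \<phi> i) = pob (mdom \<phi>) i \<and> cod2 A (mob \<phi> i) = pob (mcod \<phi>) i"
    and natural: "u \<in> Mor I \<Longrightarrow>
      pmor (mcod \<phi>) u \<cdot>\<^bsub>A\<^esub> (id2 A (fmor (ptgt (mdom \<phi>)) u) \<star>\<^bsub>A\<^esub> mob \<phi> (src I u)) =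
      (mob \<phi> (tgt I u) \<star>\<^bsub>A\<^esub> id2 A (fmor (psrc (mdom \<phi>)) u)) \<cdot>\<^bsub>A\<^esub> pmor (mdom \<phi>) u"

definition psnat_id :: "('i, 'u, 's) two_cat \<Rightarrow> ('o, 'm, 'c) two_cat \<Rightarrow>
    ('i, 'u, 's, 'o, 'm, 'c) tfun \<Rightarrow> ('i, 'u, 's, 'o, 'm, 'c) psnat" where
  "psnat_id I A F = \<lparr>psrc = F, ptgt = F,
     pob = (\<lambda>i\<in>Ob I. id1 A (fob F i)), pmor = (\<lambda>u\<in>Mor I. id2 A (fmor F u))\<rparr>"

definition psnat_comp :: "('i, 'u, 's) two_cat \<Rightarrow> ('o, 'm, 'c) two_cat \<Rightarrow>
    ('i, 'u, 's, 'o, 'm, 'c) psnat \<Rightarrow> ('i, 'u, 's, 'o, 'm, 'c) psnat \<Rightarrow>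
    ('i, 'u, 's, 'o, 'm, 'c) psnat" where
  "psnat_comp I A \<nu> \<mu> = \<lparr>psrc = psrc \<mu>, ptgt = ptgt \<nu>,
     pob = (\<lambda>i\<in>Ob I. pob \<nu> i \<odot>\<^bsub>A\<^esub> pob \<mu> i),
     pmor = (\<lambda>u\<in>Mor I. (id2 A (pob \<nu> (tgt I u)) \<star>\<^bsub>A\<^esub> pmor \<mu> u) \<cdot>\<^bsub>A\<^esub>
                       (pmor \<nu> u \<star>\<^bsub>A\<^esub> id2 A (pob \<mu> (src I u))))\<rparr>"

definition Ps :: "('i, 'u, 's) two_cat \<Rightarrow> ('o, 'm, 'c) two_cat \<Rightarrow>
    (('i, 'u, 's, 'o, 'm, 'c) tfun, ('i, 'u, 's, 'o, 'm, 'c) psnat,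
     ('i, 'u, 's, 'o, 'm, 'c) modif) two_cat" where
  "Ps I A = \<lparr>
     Ob = Collect (two_functor I A),
     Mor = Collect (pseudo_nat I A),
     Cell = Collect (modification I A),
     src = psrc, tgt = ptgt, dom2 = mdom, cod2 = mcod,
     id1 = psnat_id I A,
     comp1 = psnat_comp I A,
     id2 = (\<lambda>\<mu>. \<lparr>mdom = \<mu>, mcod = \<mu>, mob = (\<lambda>i\<in>Ob I. id2 A (pob \<mu> i))\<rparr>),
     vcomp = (\<lambda>\<psi> \<phi>. \<lparr>mdom = mdom \<phi>, mcod = mcod \<psi>, mob = (\<lambda>i\<in>Ob I. mob \<psi> i \<cdot>\<^bsub>A\<^esub> mob \<phi> i)\<rparr>),
     hcomp = (\<lambda>\<psi> \<phi>. \<lparr>mdom = psnat_comp I A (mdom \<psi>) (mdom \<phi>),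
                      mcod = psnat_comp I A (mcod \<psi>) (mcod \<phi>),
                      mob = (\<lambda>i\<in>Ob I. mob \<psi> i \<star>\<^bsub>A\<^esub> mob \<phi> i)\<rparr>)\<rparr>"

text \<open>The three components of the diagonal 2-functor \<open>\<Delta> : A \<rightarrow> Ps[I,A]\<close>.\<close>

definition const_ob :: "('i, 'u, 's) two_cat \<Rightarrow> ('o, 'm, 'c) two_cat \<Rightarrow> 'o \<Rightarrow>
    ('i, 'u, 's, 'o, 'm, 'c) tfun" where
  "const_ob I A X = \<lparr>fob = (\<lambda>i\<in>Ob I. X), fmor = (\<lambda>u\<in>Mor I. id1 A X),
     fcell = (\<lambda>s\<in>Cell I. id2 A (id1 A X))\<rparr>"

definition const_mor :: "('i, 'u, 's) two_cat \<Rightarrow> ('o, 'm, 'c) two_cat \<Rightarrow> 'm \<Rightarrow>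
    ('i, 'u, 's, 'o, 'm, 'c) psnat" where
  "const_mor I A f = \<lparr>psrc = const_ob I A (src A f), ptgt = const_ob I A (tgt A f),
     pob = (\<lambda>i\<in>Ob I. f), pmor = (\<lambda>u\<in>Mor I. id2 A f)\<rparr>"

definition const_cell :: "('i, 'u, 's) two_cat \<Rightarrow> ('o, 'm, 'c) two_cat \<Rightarrow> 'c \<Rightarrow>
    ('i, 'u, 's, 'o, 'm, 'c) modif" where
  "const_cell I A a = \<lparr>mdom = const_mor I A (dom2 A a), mcod = const_mor I A (cod2 A a),
     mob = (\<lambda>i\<in>Ob I. a)\<rparr>"


section \<open>Pseudo-limits, the lax-slice and 2-terminal objects\<close>

definition pseudo_cone :: "('i, 'u, 's) two_cat \<Rightarrow> ('o, 'm, 'c) two_cat \<Rightarrow>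
    ('i, 'u, 's, 'o, 'm, 'c) tfun \<Rightarrow> 'o \<Rightarrow> ('i, 'u, 's, 'o, 'm, 'c) psnat \<Rightarrow> bool" where
  "pseudo_cone I A F X \<mu> \<longleftrightarrow>
     X \<in> Ob A \<and> \<mu> \<in> Mor (Ps I A) \<and> psrc \<mu> = const_ob I A X \<and> ptgt \<mu> = F"

definition postcomp_const :: "('i, 'u, 's) two_cat \<Rightarrow> ('o, 'm, 'c) two_cat \<Rightarrow>
    ('i, 'u, 's, 'o, 'm, 'c) psnat \<Rightarrow>
    ('m, 'c, ('i, 'u, 's, 'o, 'm, 'c) psnat, ('i, 'u, 's, 'o, 'm, 'c) modif) cfun" where
  "postcomp_const I A l = \<lparr>
     cfob = (\<lambda>f. l \<odot>\<^bsub>Ps I A\<^esub> const_mor I A f),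
     cfarr = (\<lambda>a. id2 (Ps I A) l \<star>\<^bsub>Ps I A\<^esub> const_cell I A a)\<rparr>"

definition is_pseudo_limit :: "('i, 'u, 's) two_cat \<Rightarrow> ('o, 'm, 'c) two_cat \<Rightarrow>
    ('i, 'u, 's, 'o, 'm, 'c) tfun \<Rightarrow> 'o \<times> ('i, 'u, 's, 'o, 'm, 'c) psnat \<Rightarrow> bool" where
  "is_pseudo_limit I A F = (\<lambda>(L, l).
     pseudo_cone I A F L l \<and>
     (\<forall>X\<in>Ob A. cat_iso (hom_cat A X L) (hom_cat (Ps I A) (const_ob I A X) F)
                 (postcomp_const I A l)))"

text \<open>In the lax-slice a morphism \<open>(f, \<phi>)\<close> is stored together with its source and target cone,
  and a 2-morphism together with its source and target morphism.\<close>

definition lax_slice :: "('i, 'u, 's) two_cat \<Rightarrow> ('o, 'm, 'c) two_cat \<Rightarrow>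
    ('i, 'u, 's, 'o, 'm, 'c) tfun \<Rightarrow>
    ('o \<times> ('i, 'u, 's, 'o, 'm, 'c) psnat,
     ('o \<times> ('i, 'u, 's, 'o, 'm, 'c) psnat) \<times> ('m \<times> ('i, 'u, 's, 'o, 'm, 'c) modif) \<times>
       ('o \<times> ('i, 'u, 's, 'o, 'm, 'c) psnat),
     (('o \<times> ('i, 'u, 's, 'o, 'm, 'c) psnat) \<times> ('m \<times> ('i, 'u, 's, 'o, 'm, 'c) modif) \<times>
       ('o \<times> ('i, 'u, 's, 'o, 'm, 'c) psnat)) \<times> 'c \<times>
     (('o \<times> ('i, 'u, 's, 'o, 'm, 'c) psnat) \<times> ('m \<times> ('i, 'u, 's, 'o, 'm, 'c) modif) \<times>
       ('o \<times> ('i, 'u, 's, 'o, 'm, 'c) psnat))) two_cat" where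
  "lax_slice I A F = (let
     P = Ps I A;
     obs = {(X, \<mu>). pseudo_cone I A F X \<mu>};
     mors = {((X, \<mu>), (f, \<phi>), (Y, \<nu>)) | X \<mu> f \<phi> Y \<nu>.
       (X, \<mu>) \<in> obs \<and> (Y, \<nu>) \<in> obs \<and>
       f \<in> Mor A \<and> src A f = X \<and> tgt A f = Y \<and>
       \<phi> \<in> Cell P \<and> dom2 P \<phi> = \<nu> \<odot>\<^bsub>P\<^esub> const_mor I A f \<and> cod2 P \<phi> = \<mu>};
     cells = {(((X, \<mu>), (f, \<phi>), (Y, \<nu>)), a, ((X, \<mu>), (g, \<psi>), (Y, \<nu>))) | X \<mu> f \<phi> Y \<nu> a g \<psi>.
       ((X, \<mu>), (f, \<phi>), (Y, \<nu>)) \<in> mors \<and> ((X, \<mu>), (g, \<psi>), (Y, \<nu>)) \<in> mors \<and>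
       a \<in> Cell A \<and> dom2 A a = f \<and> cod2 A a = g \<and>
       \<psi> \<cdot>\<^bsub>P\<^esub> (id2 P \<nu> \<star>\<^bsub>P\<^esub> const_cell I A a) = \<phi>};
     cmp = (\<lambda>(V, (g, \<psi>), W) (U, (f, \<phi>), V').
       (U, (g \<odot>\<^bsub>A\<^esub> f, \<phi> \<cdot>\<^bsub>P\<^esub> (\<psi> \<star>\<^bsub>P\<^esub> id2 P (const_mor I A f))), W))
   in \<lparr>
     Ob = obs, Mor = mors, Cell = cells,
     src = fst, tgt = (\<lambda>(U, m, V). V), dom2 = fst, cod2 = (\<lambda>(p, a, q). q),
     id1 = (\<lambda>(X, \<mu>). ((X, \<mu>), (id1 A X, id2 P \<mu>), (X, \<mu>))),
     comp1 = cmp,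
     id2 = (\<lambda>p. case p of (U, (f, \<phi>), V) \<Rightarrow> (p, id2 A f, p)),
     vcomp = (\<lambda>(q', b, r) (p, a, q). (p, b \<cdot>\<^bsub>A\<^esub> a, r)),
     hcomp = (\<lambda>(p', b, q') (p, a, q). (cmp p' p, b \<star>\<^bsub>A\<^esub> a, cmp q' q))\<rparr>)"

definition two_terminal :: "('o, 'm, 'c) two_cat \<Rightarrow> 'o \<Rightarrow> bool" where
  "two_terminal B L \<longleftrightarrow> L \<in> Ob B \<and> (\<forall>X\<in>Ob B. isomorphic_cats (hom_cat B X L) terminal_cat)"


section \<open>The 2-category given by generators and relations\<close>

datatype ('o, 'e) mterm =
    MId 'o
  | MGen 'e
  | MComp "('o, 'e) mterm" "('o, 'e) mterm"

datatype ('o, 'e, 'd) cterm =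
    CId "('o, 'e) mterm"
  | CGen 'd
  | CVert "('o, 'e, 'd) cterm" "('o, 'e, 'd) cterm"
  | CHorz "('o, 'e, 'd) cterm" "('o, 'e, 'd) cterm"

text \<open>The generating objects, morphisms and 2-morphisms are all elements of the respective types;
  the relations are between morphisms.\<close>

record ('o, 'e, 'd) presentation =
  gsrc :: "'e \<Rightarrow> 'o"
  gtgt :: "'e \<Rightarrow> 'o"
  gdom :: "'d \<Rightarrow> ('o, 'e) mterm"
  gcod :: "'d \<Rightarrow> ('o, 'e) mterm"
  rels :: "(('o, 'e) mterm \<times> ('o, 'e) mterm) set"

text \<open>\<open>meq P x y s t\<close>: the terms \<open>s\<close> and \<open>t\<close> are well-formed morphisms \<open>x \<rightarrow> y\<close> and are identified.
  In particular, \<open>meq P x y s s\<close> says that \<open>s\<close> is a well-formed morphism \<open>x \<rightarrow> y\<close>.\<close>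

inductive meq :: "('o, 'e, 'd) presentation \<Rightarrow> 'o \<Rightarrow> 'o \<Rightarrow> ('o, 'e) mterm \<Rightarrow> ('o, 'e) mterm \<Rightarrow> bool"
  for P where
  ident: "meq P x x (MId x) (MId x)"
| gen: "meq P (gsrc P e) (gtgt P e) (MGen e) (MGen e)"
| comp: "\<lbrakk>meq P x y s s'; meq P y z t t'\<rbrakk> \<Longrightarrow> meq P x z (MComp t s) (MComp t' s')"
| rel: "\<lbrakk>(s, t) \<in> rels P; meq P x y s s; meq P x y t t\<rbrakk> \<Longrightarrow> meq P x y s t"
| sym: "meq P x y s t \<Longrightarrow> meq P x y t s"
| trans: "\<lbrakk>meq P x y s t; meq P x y t u\<rbrakk> \<Longrightarrow> meq P x y s u"
| id_left: "meq P x y s s \<Longrightarrow> meq P x y (MComp (MId y) s) s"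
| id_right: "meq P x y s s \<Longrightarrow> meq P x y (MComp s (MId x)) s"
| assoc: "\<lbrakk>meq P w x s s; meq P x y t t; meq P y z u u\<rbrakk> \<Longrightarrow>
    meq P w z (MComp u (MComp t s)) (MComp (MComp u t) s)"

text \<open>\<open>ceq P x y p q a b\<close>: the terms \<open>a\<close> and \<open>b\<close> are well-formed 2-morphisms \<open>p \<Rightarrow> q : x \<rightarrow> y\<close> and
  are identified.\<close>

inductive ceq :: "('o, 'e, 'd) presentation \<Rightarrow> 'o \<Rightarrow> 'o \<Rightarrow> ('o, 'e) mterm \<Rightarrow> ('o, 'e) mterm \<Rightarrow>
    ('o, 'e, 'd) cterm \<Rightarrow> ('o, 'e, 'd) cterm \<Rightarrow> bool"
  for P where
  ident: "meq P x y p p' \<Longrightarrow> ceq P x y p p (CId p) (CId p')"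
| gen: "\<lbrakk>meq P x y (gdom P d) (gdom P d); meq P x y (gcod P d) (gcod P d)\<rbrakk> \<Longrightarrow>
    ceq P x y (gdom P d) (gcod P d) (CGen d) (CGen d)"
| conv: "\<lbrakk>ceq P x y p q a b; meq P x y p p'; meq P x y q q'\<rbrakk> \<Longrightarrow> ceq P x y p' q' a b"
| vert: "\<lbrakk>ceq P x y p q a a'; ceq P x y q r b b'\<rbrakk> \<Longrightarrow> ceq P x y p r (CVert b a) (CVert b' a')"
| horz: "\<lbrakk>ceq P x y p q a a'; ceq P y z p' q' b b'\<rbrakk> \<Longrightarrow>
    ceq P x z (MComp p' p) (MComp q' q) (CHorz b a) (CHorz b' a')"
| sym: "ceq P x y p q a b \<Longrightarrow> ceq P x y p q b a"
| trans: "\<lbrakk>ceq P x y p q a b; ceq P x y p q b c\<rbrakk> \<Longrightarrow> ceq P x y p q a c"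
| vert_id_left: "ceq P x y p q a a \<Longrightarrow> ceq P x y p q (CVert (CId q) a) a"
| vert_id_right: "ceq P x y p q a a \<Longrightarrow> ceq P x y p q (CVert a (CId p)) a"
| vert_assoc: "\<lbrakk>ceq P x y p q a a; ceq P x y q r b b; ceq P x y r s c c\<rbrakk> \<Longrightarrow>
    ceq P x y p s (CVert c (CVert b a)) (CVert (CVert c b) a)"
| horz_id_left: "ceq P x y p q a a \<Longrightarrow> ceq P x y p q (CHorz (CId (MId y)) a) a"
| horz_id_right: "ceq P x y p q a a \<Longrightarrow> ceq P x y p q (CHorz a (CId (MId x))) a"
| horz_assoc: "\<lbrakk>ceq P w x p q a a; ceq P x y p' q' b b; ceq P y z p'' q'' c c\<rbrakk> \<Longrightarrow>
    ceq P w z (MComp p'' (MComp p' p)) (MComp q'' (MComp q' q))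
      (CHorz c (CHorz b a)) (CHorz (CHorz c b) a)"
| horz_ident: "\<lbrakk>meq P x y p p; meq P y z q q\<rbrakk> \<Longrightarrow>
    ceq P x z (MComp q p) (MComp q p) (CHorz (CId q) (CId p)) (CId (MComp q p))"
| interchange: "\<lbrakk>ceq P x y p q a a; ceq P x y q r b b; ceq P y z p' q' c c; ceq P y z q' r' d d\<rbrakk> \<Longrightarrow>
    ceq P x z (MComp p' p) (MComp r' r)
      (CHorz (CVert d c) (CVert b a)) (CVert (CHorz d b) (CHorz c a))"

type_synonym ('o, 'e) pmorph = "'o \<times> ('o, 'e) mterm set \<times> 'o"
type_synonym ('o, 'e, 'd) pcell = "('o, 'e) pmorph \<times> ('o, 'e, 'd) cterm set \<times> ('o, 'e) pmorph"

definition mclass :: "('o, 'e, 'd) presentation \<Rightarrow> ('o, 'e) mterm \<Rightarrow> ('o, 'e) mterm set" where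
  "mclass P t = {s. \<exists>x y. meq P x y s t}"

definition cclass :: "('o, 'e, 'd) presentation \<Rightarrow> ('o, 'e, 'd) cterm \<Rightarrow> ('o, 'e, 'd) cterm set" where
  "cclass P a = {b. \<exists>x y p q. ceq P x y p q b a}"

definition presented :: "('o, 'e, 'd) presentation \<Rightarrow>
    ('o, ('o, 'e) pmorph, ('o, 'e, 'd) pcell) two_cat" where
  "presented P = \<lparr>
     Ob = UNIV,
     Mor = {(x, mclass P t, y) | x y t. meq P x y t t},
     Cell = {((x, mclass P p, y), cclass P a, (x, mclass P q, y)) | x y p q a. ceq P x y p q a a},
     src = fst, tgt = (\<lambda>(x, T, y). y), dom2 = fst, cod2 = (\<lambda>(f, A, g). g),
     id1 = (\<lambda>x. (x, mclass P (MId x), x)),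
     comp1 = (\<lambda>(y', T, z) (x, S, y). (x, \<Union>t\<in>T. \<Union>s\<in>S. mclass P (MComp t s), z)),
     id2 = (\<lambda>(x, T, y). ((x, T, y), \<Union>t\<in>T. cclass P (CId t), (x, T, y))),
     vcomp = (\<lambda>(g', B, h) (f, A, g). (f, \<Union>b\<in>B. \<Union>a\<in>A. cclass P (CVert b a), h)),
     hcomp = (\<lambda>((y', S', z'), B, (v', T', w')) ((x, S, y), A, (v, T, w)).
       ((x, \<Union>s'\<in>S'. \<Union>s\<in>S. mclass P (MComp s' s), z'),
        \<Union>b\<in>B. \<Union>a\<in>A. cclass P (CHorz b a),
        (v, \<Union>t'\<in>T'. \<Union>t\<in>T. mclass P (MComp t' t), w')))\<rparr>"

definition gen_mor :: "('o, 'e, 'd) presentation \<Rightarrow> 'e \<Rightarrow> ('o, 'e) pmorph" where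
  "gen_mor P e = (gsrc P e, mclass P (MGen e), gtgt P e)"


section \<open>The example\<close>

datatype shape_ob = Left | Right | Corner

datatype shape_arr = Ident shape_ob | FromLeft | FromRight

fun shape_dom :: "shape_arr \<Rightarrow> shape_ob" where
  "shape_dom (Ident i) = i"
| "shape_dom FromLeft = Left"
| "shape_dom FromRight = Right"

fun shape_cod :: "shape_arr \<Rightarrow> shape_ob" where
  "shape_cod (Ident i) = i"
| "shape_cod FromLeft = Corner"
| "shape_cod FromRight = Corner"

text \<open>Of two composable arrows at least one is an identity.\<close>

fun shape_comp :: "shape_arr \<Rightarrow> shape_arr \<Rightarrow> shape_arr" where
  "shape_comp (Ident i) u = u"
| "shape_comp v u = v"

definition pullback_shape :: "(shape_ob, shape_arr) cat" where
  "pullback_shape = \<lparr>Obj = UNIV, Arr = UNIV, cdom = shape_dom, ccod = shape_cod,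
     cid = Ident, ccomp = shape_comp\<rparr>"

abbreviation ex_I :: "(shape_ob, shape_arr, shape_arr) two_cat" where
  "ex_I \<equiv> locally_discrete pullback_shape"

datatype ex_ob = obX | obL | obA | obB | obC

datatype ex_gen = gf | gg | gl0 | gl1 | gb | gc

datatype ex_gen2 = galpha

primrec ex_src :: "ex_gen \<Rightarrow> ex_ob" where
  "ex_src gf = obX" | "ex_src gg = obX" | "ex_src gl0 = obL" | "ex_src gl1 = obL"
| "ex_src gb = obB" | "ex_src gc = obC"

primrec ex_tgt :: "ex_gen \<Rightarrow> ex_ob" where
  "ex_tgt gf = obL" | "ex_tgt gg = obL" | "ex_tgt gl0 = obB" | "ex_tgt gl1 = obC"
| "ex_tgt gb = obA" | "ex_tgt gc = obA"

definition ex_pres :: "(ex_ob, ex_gen, ex_gen2) presentation" where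
  "ex_pres = \<lparr>gsrc = ex_src, gtgt = ex_tgt, gdom = (\<lambda>_. MGen gf), gcod = (\<lambda>_. MGen gg),
     rels = {(MComp (MGen gb) (MGen gl0), MComp (MGen gc) (MGen gl1))}\<rparr>"

definition ex_A :: "(ex_ob, (ex_ob, ex_gen) pmorph, (ex_ob, ex_gen, ex_gen2) pcell) two_cat" where
  "ex_A = presented ex_pres"

abbreviation ex_mor :: "ex_gen \<Rightarrow> (ex_ob, ex_gen) pmorph" where
  "ex_mor \<equiv> gen_mor ex_pres"

primrec ex_F_ob :: "shape_ob \<Rightarrow> ex_ob" where
  "ex_F_ob Left = obB" | "ex_F_ob Right = obC" | "ex_F_ob Corner = obA"

primrec ex_F_mor :: "shape_arr \<Rightarrow> (ex_ob, ex_gen) pmorph" where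
  "ex_F_mor (Ident i) = id1 ex_A (ex_F_ob i)"
| "ex_F_mor FromLeft = ex_mor gb"
| "ex_F_mor FromRight = ex_mor gc"

definition ex_F :: "(shape_ob, shape_arr, shape_arr,
    ex_ob, (ex_ob, ex_gen) pmorph, (ex_ob, ex_gen, ex_gen2) pcell) tfun" where
  "ex_F = \<lparr>fob = ex_F_ob, fmor = ex_F_mor, fcell = (\<lambda>u. id2 ex_A (ex_F_mor u))\<rparr>"

primrec ex_cone_ob :: "shape_ob \<Rightarrow> (ex_ob, ex_gen) pmorph" where
  "ex_cone_ob Left = ex_mor gl0"
| "ex_cone_ob Right = ex_mor gl1"
| "ex_cone_ob Corner = ex_mor gb \<odot>\<^bsub>ex_A\<^esub> ex_mor gl0"

definition ex_cone :: "(shape_ob, shape_arr, shape_arr,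
    ex_ob, (ex_ob, ex_gen) pmorph, (ex_ob, ex_gen, ex_gen2) pcell) psnat" where
  "ex_cone = \<lparr>psrc = const_ob ex_I ex_A obL, ptgt = ex_F, pob = ex_cone_ob,
     pmor = (\<lambda>u. id2 ex_A (ex_cone_ob (shape_cod u)))\<rparr>"

end

(*
  The 2-category A is locally posetal: parallel 2-morphisms are equal, and the only
  non-identity 2-morphisms are the whiskerings n * alpha. Hence all invertible 2-morphisms are
  identities, pseudo-cones over F are strict cones, and modifications are pointwise inequalities.
  Cones with vertex X are thus lambda f and lambda g with the single inequality lambda alpha, which
  makes L a pseudo-limit. In the lax-slice, however, both (f, lambda alpha) and (g, id) are morphisms
  from (X, lambda g) to (L, lambda).
*)
theory Submission
  imports Defs
begin

section \<open>Presented 2-categories\<close>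

text \<open>The 2-category is a quotient of syntax, so two questions have to be settled: which
  morphisms stay distinct, and what all of them look like. Distinctness comes from an invariant of
  terms, the occurrence of the generator \<open>gg\<close>, which descends to morphisms as
  \<open>flag\<close>. The converse comes from normal forms that depend only on source, target and
  flag. The flag is thus a complete invariant of parallel morphisms, and equations between morphisms
  turn into equations between booleans. For 2-morphisms no word problem has to be solved: by
  induction on terms each one is an identity or a whiskering of \<open>\<alpha>\<close>, and the
  flags of domain and codomain tell the two cases apart, so the boundary determines the 2-morphism.
  Along a 2-morphism the flag can only rise, which gives antisymmetry. The legs of the cone are
  unflagged, so composition with a leg neither loses nor creates a flag; this yields uniqueness and
  fullness. For an arbitrary cone the corner component forces a common flag on all components, and
  that flag selects the factorization.\<close>

primrec term_src :: "('o, 'e, 'd) presentation \<Rightarrow> ('o, 'e) mterm \<Rightarrow> 'o" where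
  "term_src P (MId x) = x"
| "term_src P (MGen e) = gsrc P e"
| "term_src P (MComp t s) = term_src P s"

primrec term_tgt :: "('o, 'e, 'd) presentation \<Rightarrow> ('o, 'e) mterm \<Rightarrow> 'o" where
  "term_tgt P (MId x) = x"
| "term_tgt P (MGen e) = gtgt P e"
| "term_tgt P (MComp t s) = term_tgt P t"

primrec wf_term :: "('o, 'e, 'd) presentation \<Rightarrow> ('o, 'e) mterm \<Rightarrow> bool" where
  "wf_term P (MId x) \<longleftrightarrow> True"
| "wf_term P (MGen e) \<longleftrightarrow> True"
| "wf_term P (MComp t s) \<longleftrightarrow> wf_term P t \<and> wf_term P s \<and> term_tgt P s = term_src P t"

lemma meq_typed:
  "meq P x y s t \<Longrightarrow> wf_term P s \<and> wf_term P t \<and> term_src P s = x \<and> term_src P t = x \<and>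
     term_tgt P s = y \<and> term_tgt P t = y"
  by (induction rule: meq.induct) auto

lemma meq_refl: "wf_term P s \<Longrightarrow> meq P (term_src P s) (term_tgt P s) s s"
  by (induction s) (auto intro: meq.intros)

lemma meq_refl': "\<lbrakk>wf_term P s; term_src P s = x; term_tgt P s = y\<rbrakk> \<Longrightarrow> meq P x y s s"
  using meq_refl by blast

lemma meq_left: "meq P x y s t \<Longrightarrow> meq P x y s s"
  and meq_right: "meq P x y s t \<Longrightarrow> meq P x y t t"
  by (blast intro: meq.sym meq.trans)+

section \<open>Boundaries and well-formedness of 2-morphism terms\<close>

primrec cell_dom :: "('o, 'e, 'd) presentation \<Rightarrow> ('o, 'e, 'd) cterm \<Rightarrow> ('o, 'e) mterm" where
  "cell_dom P (CId p) = p"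
| "cell_dom P (CGen d) = gdom P d"
| "cell_dom P (CVert b a) = cell_dom P a"
| "cell_dom P (CHorz b a) = MComp (cell_dom P b) (cell_dom P a)"

primrec cell_cod :: "('o, 'e, 'd) presentation \<Rightarrow> ('o, 'e, 'd) cterm \<Rightarrow> ('o, 'e) mterm" where
  "cell_cod P (CId p) = p"
| "cell_cod P (CGen d) = gcod P d"
| "cell_cod P (CVert b a) = cell_cod P b"
| "cell_cod P (CHorz b a) = MComp (cell_cod P b) (cell_cod P a)"

abbreviation cell_src :: "('o, 'e, 'd) presentation \<Rightarrow> ('o, 'e, 'd) cterm \<Rightarrow> 'o" where
  "cell_src P a \<equiv> term_src P (cell_dom P a)"

abbreviation cell_tgt :: "('o, 'e, 'd) presentation \<Rightarrow> ('o, 'e, 'd) cterm \<Rightarrow> 'o" where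
  "cell_tgt P a \<equiv> term_tgt P (cell_dom P a)"

text \<open>Two 2-morphisms may be stacked when their middle morphisms agree in the quotient, not
  letter by letter; hence \<open>meq\<close> in the vertical clause. The horizontal clause compares
  objects, which are never identified.\<close>

primrec wf_cell :: "('o, 'e, 'd) presentation \<Rightarrow> ('o, 'e, 'd) cterm \<Rightarrow> bool" where
  "wf_cell P (CId p) \<longleftrightarrow> wf_term P p"
| "wf_cell P (CGen d) \<longleftrightarrow> wf_term P (gdom P d) \<and> wf_term P (gcod P d) \<and>
     term_src P (gdom P d) = term_src P (gcod P d) \<and> term_tgt P (gdom P d) = term_tgt P (gcod P d)"
| "wf_cell P (CVert b a) \<longleftrightarrow> wf_cell P b \<and> wf_cell P a \<and>
     meq P (cell_src P a) (cell_tgt P a) (cell_cod P a) (cell_dom P b)"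
| "wf_cell P (CHorz b a) \<longleftrightarrow> wf_cell P b \<and> wf_cell P a \<and> cell_tgt P a = cell_src P b"

lemma wf_cell_typed:
  "wf_cell P a \<Longrightarrow> wf_term P (cell_dom P a) \<and> wf_term P (cell_cod P a) \<and>
     term_src P (cell_cod P a) = cell_src P a \<and> term_tgt P (cell_cod P a) = cell_tgt P a"
  by (induction a) (auto dest: meq_typed)

lemma ceq_typed:
  "ceq P x y p q a b \<Longrightarrow> wf_cell P a \<and> wf_cell P b \<and> meq P x y p (cell_dom P a) \<and>
     meq P x y q (cell_cod P a) \<and> meq P x y p (cell_dom P b) \<and> meq P x y q (cell_cod P b)"
proof (induction rule: ceq.induct)
  case (ident x y p p')
  then show ?case by (auto dest: meq_left meq_typed)
next
  case (gen x y d)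
  then show ?case by (auto dest: meq_typed)
next
  case (conv x y p q a b p' q')
  then show ?case by (meson meq.sym meq.trans)
next
  case (vert x y p q a a' r b b')
  then have "meq P x y (cell_cod P a) (cell_dom P b)" "meq P x y (cell_cod P a') (cell_dom P b')"
    by (meson meq.sym meq.trans)+
  moreover have "cell_src P a = x" "cell_tgt P a = y" "cell_src P a' = x" "cell_tgt P a' = y"
    using vert by (auto dest: meq_typed)
  ultimately show ?case using vert by auto
next
  case (horz x y p q a a' z p' q' b b')
  moreover have "cell_tgt P a = cell_src P b" "cell_tgt P a' = cell_src P b'"
    using horz meq_typed by metis+
  ultimately show ?case by (auto intro: meq.comp)
next
  case (sym x y p q a b)
  then show ?case by blast
next
  case (trans x y p q a b c)
  then show ?case by blast
next
  case (vert_id_left x y p q a)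
  moreover from this have "meq P (cell_src P a) (cell_tgt P a) (cell_cod P a) q" "wf_term P q"
    by (metis meq.sym meq_typed)+
  ultimately show ?case by (auto dest: meq_left)
next
  case (vert_id_right x y p q a)
  moreover from this have "meq P (term_src P p) (term_tgt P p) p (cell_dom P a)" "wf_term P p"
    by (metis meq_typed)+
  ultimately show ?case by (auto dest: meq_left)
next
  case (vert_assoc x y p q a r b s c)
  then have "meq P x y (cell_cod P a) (cell_dom P b)" "meq P x y (cell_cod P b) (cell_dom P c)"
    by (meson meq.sym meq.trans)+
  moreover have "cell_src P a = x" "cell_tgt P a = y" "cell_src P b = x" "cell_tgt P b = y"
    using vert_assoc by (auto dest: meq_typed)
  ultimately show ?case using vert_assoc by auto
next
  case (horz_id_left x y p q a)
  moreover from this have "meq P x y p (MComp (MId y) (cell_dom P a))"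
      "meq P x y q (MComp (MId y) (cell_cod P a))"
    by (meson meq.id_left meq.sym meq.trans meq_right)+
  ultimately show ?case by (auto dest: meq_typed)
next
  case (horz_id_right x y p q a)
  moreover from this have "meq P x y p (MComp (cell_dom P a) (MId x))"
      "meq P x y q (MComp (cell_cod P a) (MId x))"
    by (meson meq.id_right meq.sym meq.trans meq_right)+
  ultimately show ?case by (auto dest: meq_typed)
next
  case (horz_assoc w x p q a y p' q' b z p'' q'' c)
  have 1: "meq P w z (MComp p'' (MComp p' p)) (MComp (cell_dom P c) (MComp (cell_dom P b) (cell_dom P a)))"
    "meq P w z (MComp q'' (MComp q' q)) (MComp (cell_cod P c) (MComp (cell_cod P b) (cell_cod P a)))"
    using horz_assoc by (blast intro: meq.comp)+
  have 2: "meq P w z (MComp (cell_dom P c) (MComp (cell_dom P b) (cell_dom P a)))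
      (MComp (MComp (cell_dom P c) (cell_dom P b)) (cell_dom P a))"
    "meq P w z (MComp (cell_cod P c) (MComp (cell_cod P b) (cell_cod P a)))
      (MComp (MComp (cell_cod P c) (cell_cod P b)) (cell_cod P a))"
    using horz_assoc by (blast intro: meq.assoc dest: meq_right)+
  have "cell_tgt P a = cell_src P b" "cell_tgt P b = cell_src P c"
    using horz_assoc meq_typed by metis+
  then show ?case using horz_assoc 1 meq.trans[OF 1(1) 2(1)] meq.trans[OF 1(2) 2(2)] by simp
next
  case (horz_ident x y p z q)
  then show ?case by (auto intro: meq.comp dest: meq_typed)
next
  case (interchange x y p q a r b z p' q' c r' d)
  then have "meq P x y (cell_cod P a) (cell_dom P b)" "meq P y z (cell_cod P c) (cell_dom P d)"
    by (meson meq.sym meq.trans)+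
  moreover have "cell_src P a = x" "cell_tgt P a = y" "cell_src P b = x" "cell_tgt P b = y"
    "cell_src P c = y" "cell_tgt P c = z" "cell_src P d = y" "cell_tgt P d = z"
    using interchange by (auto dest: meq_typed)
  ultimately show ?case using interchange by (auto intro: meq.comp)
qed

lemma ceq_refl:
  "wf_cell P a \<Longrightarrow> ceq P (cell_src P a) (cell_tgt P a) (cell_dom P a) (cell_cod P a) a a"
proof (induction a)
  case (CId p)
  then show ?case by (auto intro: ceq.ident meq_refl)
next
  case (CGen d)
  then show ?case by (auto intro!: ceq.gen meq_refl')
next
  case (CVert b a)
  let ?x = "cell_src P a" and ?y = "cell_tgt P a"
  from CVert have m: "meq P ?x ?y (cell_cod P a) (cell_dom P b)" by simp
  have "cell_src P b = ?x" "cell_tgt P b = ?y" using meq_typed[OF m] by auto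
  with CVert have b: "ceq P ?x ?y (cell_dom P b) (cell_cod P b) b b" by simp
  have "meq P ?x ?y (cell_cod P b) (cell_cod P b)"
    using ceq_typed[OF b] by blast
  \<comment> \<open>\<open>vert\<close> wants literally the same middle morphism, while
    \<open>a\<close> and \<open>b\<close> meet only up to \<open>meq\<close>; \<open>conv\<close>
    moves the domain of \<open>b\<close> to the codomain of \<open>a\<close>.\<close>
  with b m have "ceq P ?x ?y (cell_cod P a) (cell_cod P b) b b"
    by (blast intro: ceq.conv meq.sym)
  with CVert show ?case by (auto intro: ceq.vert)
next
  case (CHorz b a)
  then show ?case by (auto intro!: ceq.horz)
qed

lemma ceq_canonical:
  assumes "ceq P x y p q a b"
  shows "ceq P (cell_src P a) (cell_tgt P a) (cell_dom P a) (cell_cod P a) a b"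
  by (metis assms ceq.conv ceq_typed meq_typed)

section \<open>Classes of well-formed terms\<close>

definition mor_of :: "('o, 'e, 'd) presentation \<Rightarrow> ('o, 'e) mterm \<Rightarrow> ('o, 'e) pmorph" where
  "mor_of P t = (term_src P t, mclass P t, term_tgt P t)"

definition cell_of :: "('o, 'e, 'd) presentation \<Rightarrow> ('o, 'e, 'd) cterm \<Rightarrow> ('o, 'e, 'd) pcell" where
  "cell_of P a = (mor_of P (cell_dom P a), cclass P a, mor_of P (cell_cod P a))"

text \<open>The objects quantified away in \<open>mclass\<close> can be recovered from the term, so
  chaining identifications through a common term meets no type clash.\<close>

lemma mclass_cong: "meq P x y s t \<Longrightarrow> mclass P s = mclass P t"
  unfolding mclass_def by (auto, metis meq.trans meq_typed, metis meq.sym meq.trans meq_typed)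

lemma mor_of_cong: "meq P x y s t \<Longrightarrow> mor_of P s = mor_of P t"
  unfolding mor_of_def by (metis mclass_cong meq_typed)

lemma mor_of_eq_iff:
  assumes "wf_term P s"
  shows "mor_of P s = mor_of P t \<longleftrightarrow> meq P (term_src P s) (term_tgt P s) s t"
proof
  assume "mor_of P s = mor_of P t"
  then have "mclass P s = mclass P t" by (simp add: mor_of_def)
  moreover have "s \<in> mclass P s" using meq_refl[OF assms] unfolding mclass_def by blast
  ultimately have "s \<in> mclass P t" by simp
  then show "meq P (term_src P s) (term_tgt P s) s t" by (auto simp: mclass_def dest: meq_typed)
qed (rule mor_of_cong)

lemma cclass_cong:
  assumes "ceq P x y p q a b"
  shows "cclass P a = cclass P b"
proof -
  \<comment> \<open>Two derivations that share the term \<open>a\<close> may carry different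
    boundary terms. Both pairs are identified with the boundary of \<open>a\<close>, so
    \<open>conv\<close> aligns them before \<open>trans\<close>.\<close>
  have *: "ceq P x' y' p' q' c a \<Longrightarrow> ceq P x' y' p' q' c b" if "ceq P x y p q a b"
    for a b c x y p q x' y' p' q'
  proof -
    assume c: "ceq P x' y' p' q' c a"
    have "x = x'" "y = y'" using ceq_typed[OF c] ceq_typed[OF that] meq_typed by metis+
    moreover have "meq P x' y' p p'" "meq P x' y' q q'"
      using ceq_typed[OF c] ceq_typed[OF that] \<open>x = x'\<close> \<open>y = y'\<close> by (meson meq.sym meq.trans)+
    ultimately show ?thesis using that c by (blast intro: ceq.conv ceq.trans)
  qed
  show ?thesis unfolding cclass_def using *[OF assms] *[OF ceq.sym[OF assms]] by blast
qed

lemma cell_of_cong: "ceq P x y p q a b \<Longrightarrow> cell_of P a = cell_of P b"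
  unfolding cell_of_def using cclass_cong ceq_typed mor_of_cong
  by (metis (no_types, lifting))

lemma Ob_presented: "Ob (presented P) = UNIV"
  by (simp add: presented_def)

lemma Mor_presented: "Mor (presented P) = mor_of P ` Collect (wf_term P)"
  unfolding presented_def mor_of_def
  by (auto dest!: meq_typed intro!: image_eqI meq_refl')

lemma Cell_presented: "Cell (presented P) = cell_of P ` Collect (wf_cell P)"
proof -
  have "((x, mclass P p, y), cclass P a, (x, mclass P q, y)) = cell_of P a \<and> wf_cell P a"
    if "ceq P x y p q a a" for x y p q a
  proof -
    have t: "wf_cell P a" "meq P x y p (cell_dom P a)" "meq P x y q (cell_cod P a)"
      using ceq_typed[OF that] by blast+
    have "mor_of P p = mor_of P (cell_dom P a)" "mor_of P q = mor_of P (cell_cod P a)"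
      using mor_of_cong[OF t(2)] mor_of_cong[OF t(3)] by simp_all
    moreover have "mor_of P p = (x, mclass P p, y)" "mor_of P q = (x, mclass P q, y)"
      using meq_typed[OF t(2)] meq_typed[OF t(3)] by (simp_all add: mor_of_def)
    ultimately show ?thesis using t by (simp add: cell_of_def)
  qed
  moreover have "\<exists>x y p q a. cell_of P b = ((x, mclass P p, y), cclass P a, (x, mclass P q, y)) \<and>
      ceq P x y p q a a" if "wf_cell P b" for b
    using ceq_refl[OF that] wf_cell_typed[OF that] unfolding cell_of_def mor_of_def by metis
  ultimately show ?thesis
    unfolding presented_def by (fastforce simp: image_iff)
qed

section \<open>The operations of the presented 2-category computed on representatives\<close>

lemma src_mor_of [simp]: "src (presented P) (mor_of P t) = term_src P t"
  and tgt_mor_of [simp]: "tgt (presented P) (mor_of P t) = term_tgt P t"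
  and dom2_cell_of [simp]: "dom2 (presented P) (cell_of P a) = mor_of P (cell_dom P a)"
  and cod2_cell_of [simp]: "cod2 (presented P) (cell_of P a) = mor_of P (cell_cod P a)"
  and id1_presented [simp]: "id1 (presented P) x = mor_of P (MId x)"
  by (simp_all add: presented_def mor_of_def cell_of_def)

text \<open>\<open>presented\<close> takes a union over all pairs of representatives. By congruence
  every member of the union is the same class, and the index sets are inhabited by \<open>t\<close>
  and \<open>s\<close>, so the union is that class. The other three operations follow the same
  pattern.\<close>

lemma comp1_mor_of [simp]:
  assumes "wf_term P s" "wf_term P t" "term_tgt P s = term_src P t"
  shows "comp1 (presented P) (mor_of P t) (mor_of P s) = mor_of P (MComp t s)"
proof -
  have "mclass P (MComp t' s') = mclass P (MComp t s)"
    if "t' \<in> mclass P t" "s' \<in> mclass P s" for s' t'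
  proof -
    from that obtain x y y' z where m: "meq P x y s' s" "meq P y' z t' t"
      by (auto simp: mclass_def)
    with assms have "y = y'" by (metis meq_typed)
    with m show ?thesis by (auto intro!: mclass_cong[OF meq.comp])
  qed
  moreover have "s \<in> mclass P s" "t \<in> mclass P t"
    using assms meq_refl unfolding mclass_def by blast+
  ultimately have "(\<Union>t'\<in>mclass P t. \<Union>s'\<in>mclass P s. mclass P (MComp t' s')) = mclass P (MComp t s)"
    by blast
  then show ?thesis by (simp add: presented_def mor_of_def)
qed

lemma id2_mor_of [simp]:
  assumes "wf_term P t"
  shows "id2 (presented P) (mor_of P t) = cell_of P (CId t)"
proof -
  have "cclass P (CId t') = cclass P (CId t)" if "t' \<in> mclass P t" for t'
  proof -
    from that obtain x y where "meq P x y t' t" by (auto simp: mclass_def)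
    from cclass_cong[OF ceq.ident[OF this]] show ?thesis .
  qed
  moreover have "t \<in> mclass P t"
    using assms meq_refl unfolding mclass_def by blast
  ultimately have "(\<Union>t'\<in>mclass P t. cclass P (CId t')) = cclass P (CId t)"
    by blast
  then show ?thesis by (simp add: presented_def mor_of_def cell_of_def)
qed

lemma mem_cclass: "wf_cell P a \<Longrightarrow> a \<in> cclass P a"
  unfolding cclass_def using ceq_refl by blast

lemma mem_cclassD:
  assumes "a' \<in> cclass P a"
  shows "ceq P (cell_src P a) (cell_tgt P a) (cell_dom P a) (cell_cod P a) a' a"
  using assms unfolding cclass_def by (auto intro: ceq.sym ceq_canonical)

lemma vcomp_cell_of [simp]:
  assumes "wf_cell P (CVert b a)"
  shows "vcomp (presented P) (cell_of P b) (cell_of P a) = cell_of P (CVert b a)"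
proof -
  have "cclass P (CVert b' a') = cclass P (CVert b a)"
    if "b' \<in> cclass P b" "a' \<in> cclass P a" for a' b'
  proof -
    let ?x = "cell_src P a" and ?y = "cell_tgt P a"
    have m: "meq P ?x ?y (cell_cod P a) (cell_dom P b)" using assms by simp
    then have "cell_src P b = ?x" "cell_tgt P b = ?y" using meq_typed by metis+
    then have b: "ceq P ?x ?y (cell_dom P b) (cell_cod P b) b' b"
      using mem_cclassD[OF that(1)] by simp
    then have "ceq P ?x ?y (cell_cod P a) (cell_cod P b) b' b"
      using m by (blast intro: ceq.conv meq.sym dest: ceq_typed meq_right)
    from cclass_cong[OF ceq.vert[OF mem_cclassD[OF that(2)] this]] show ?thesis .
  qed
  moreover have "b \<in> cclass P b" "a \<in> cclass P a" using assms mem_cclass by auto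
  ultimately have "(\<Union>b'\<in>cclass P b. \<Union>a'\<in>cclass P a. cclass P (CVert b' a')) = cclass P (CVert b a)"
    by blast
  then show ?thesis by (simp add: presented_def cell_of_def)
qed

lemma hcomp_cell_of [simp]:
  assumes "wf_cell P (CHorz b a)"
  shows "hcomp (presented P) (cell_of P b) (cell_of P a) = cell_of P (CHorz b a)"
proof -
  have "cclass P (CHorz b' a') = cclass P (CHorz b a)"
    if "b' \<in> cclass P b" "a' \<in> cclass P a" for a' b'
  proof -
    have "ceq P (cell_src P a) (cell_src P b) (cell_dom P a) (cell_cod P a) a' a"
      using mem_cclassD[OF that(2)] assms by simp
    from cclass_cong[OF ceq.horz[OF this mem_cclassD[OF that(1)]]] show ?thesis .
  qed
  moreover have "b \<in> cclass P b" "a \<in> cclass P a" using assms mem_cclass by auto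
  ultimately have 1: "(\<Union>b'\<in>cclass P b. \<Union>a'\<in>cclass P a. cclass P (CHorz b' a')) = cclass P (CHorz b a)"
    by blast
  have "mor_of P (MComp (cell_dom P b) (cell_dom P a)) =
      comp1 (presented P) (mor_of P (cell_dom P b)) (mor_of P (cell_dom P a))"
    "mor_of P (MComp (cell_cod P b) (cell_cod P a)) =
      comp1 (presented P) (mor_of P (cell_cod P b)) (mor_of P (cell_cod P a))"
    using assms by (simp_all add: wf_cell_typed)
  with 1 show ?thesis by (simp add: presented_def cell_of_def mor_of_def)
qed

lemma wf_cell_CVert_iff:
  assumes "wf_cell P a" "wf_cell P b"
  shows "wf_cell P (CVert b a) \<longleftrightarrow> mor_of P (cell_cod P a) = mor_of P (cell_dom P b)"
  using assms by (simp add: mor_of_eq_iff wf_cell_typed)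

text \<open>Each equational axiom is a constructor of \<open>meq\<close> or \<open>ceq\<close> read
  on representatives. The work lies in the well-formedness of the composite terms, which allows the
  operations to be computed on them.\<close>

theorem two_category_presented: "two_category (presented P)"
proof
  fix f assume "f \<in> Mor (presented P)"
  then obtain s where s: "f = mor_of P s" "wf_term P s" by (auto simp: Mor_presented)
  show "src (presented P) f \<in> Ob (presented P) \<and> tgt (presented P) f \<in> Ob (presented P)"
    by (simp add: Ob_presented)
  show "comp1 (presented P) (id1 (presented P) (tgt (presented P) f)) f = f"
    using s meq.id_left[OF meq_refl] by (auto intro: mor_of_cong)
  show "comp1 (presented P) f (id1 (presented P) (src (presented P) f)) = f"
    using s meq.id_right[OF meq_refl] by (auto intro: mor_of_cong)
  show "id2 (presented P) f \<in> Cell (presented P) \<and> dom2 (presented P) (id2 (presented P) f) = f \<and>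
      cod2 (presented P) (id2 (presented P) f) = f"
    using s by (simp add: Cell_presented)
  fix g assume "g \<in> Mor (presented P)" and fg: "tgt (presented P) f = src (presented P) g"
  then obtain t where t: "g = mor_of P t" "wf_term P t" by (auto simp: Mor_presented)
  show "comp1 (presented P) g f \<in> Mor (presented P) \<and>
      src (presented P) (comp1 (presented P) g f) = src (presented P) f \<and>
      tgt (presented P) (comp1 (presented P) g f) = tgt (presented P) g"
    using s t fg by (simp add: Mor_presented)
  show "hcomp (presented P) (id2 (presented P) g) (id2 (presented P) f) =
      id2 (presented P) (comp1 (presented P) g f)"
    using s t fg by (auto intro: cell_of_cong ceq.horz_ident meq_refl')
  fix h assume "h \<in> Mor (presented P)" and gh: "tgt (presented P) g = src (presented P) h"
  then obtain u where u: "h = mor_of P u" "wf_term P u" by (auto simp: Mor_presented)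
  show "comp1 (presented P) h (comp1 (presented P) g f) =
      comp1 (presented P) (comp1 (presented P) h g) f"
    using s t u fg gh by (auto intro!: mor_of_cong meq.assoc meq_refl')
next
  fix X
  show "id1 (presented P) X \<in> Mor (presented P) \<and> src (presented P) (id1 (presented P) X) = X \<and>
      tgt (presented P) (id1 (presented P) X) = X"
    by (simp add: Mor_presented)
next
  fix \<alpha> assume "\<alpha> \<in> Cell (presented P)"
  then obtain a where a: "\<alpha> = cell_of P a" "wf_cell P a" by (auto simp: Cell_presented)
  note ta = wf_cell_typed[OF a(2)]
  have ra: "ceq P (cell_src P a) (cell_tgt P a) (cell_dom P a) (cell_cod P a) a a"
    by (rule ceq_refl[OF a(2)])
  show "dom2 (presented P) \<alpha> \<in> Mor (presented P) \<and> cod2 (presented P) \<alpha> \<in> Mor (presented P) \<and>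
      src (presented P) (dom2 (presented P) \<alpha>) = src (presented P) (cod2 (presented P) \<alpha>) \<and>
      tgt (presented P) (dom2 (presented P) \<alpha>) = tgt (presented P) (cod2 (presented P) \<alpha>)"
    using a ta by (simp add: Mor_presented)
  have "wf_cell P (CVert (CId (cell_cod P a)) a)"
    using a ta by (simp del: wf_cell.simps(3) add: wf_cell_CVert_iff)
  then show "vcomp (presented P) (id2 (presented P) (cod2 (presented P) \<alpha>)) \<alpha> = \<alpha>"
    using a ta ceq.vert_id_left[OF ra] by (auto simp del: wf_cell.simps(3) intro: cell_of_cong)
  have "wf_cell P (CVert a (CId (cell_dom P a)))"
    using a ta by (simp del: wf_cell.simps(3) add: wf_cell_CVert_iff)
  then show "vcomp (presented P) \<alpha> (id2 (presented P) (dom2 (presented P) \<alpha>)) = \<alpha>"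
    using a ta ceq.vert_id_right[OF ra] by (auto simp del: wf_cell.simps(3) intro: cell_of_cong)
  show "hcomp (presented P) (id2 (presented P) (id1 (presented P) (tgt (presented P) (dom2 (presented P) \<alpha>)))) \<alpha> = \<alpha>"
    using a ta ceq.horz_id_left[OF ra] by (auto intro: cell_of_cong)
  show "hcomp (presented P) \<alpha> (id2 (presented P) (id1 (presented P) (src (presented P) (dom2 (presented P) \<alpha>)))) = \<alpha>"
    using a ta ceq.horz_id_right[OF ra] by (auto intro: cell_of_cong)
  fix \<beta> assume "\<beta> \<in> Cell (presented P)"
  then obtain b where b: "\<beta> = cell_of P b" "wf_cell P b" by (auto simp: Cell_presented)
  note tb = wf_cell_typed[OF b(2)]
  {
    assume "tgt (presented P) (dom2 (presented P) \<alpha>) = src (presented P) (dom2 (presented P) \<beta>)"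
    with a b have ab: "cell_tgt P a = cell_src P b" by simp
    show "hcomp (presented P) \<beta> \<alpha> \<in> Cell (presented P) \<and>
        dom2 (presented P) (hcomp (presented P) \<beta> \<alpha>) =
          comp1 (presented P) (dom2 (presented P) \<beta>) (dom2 (presented P) \<alpha>) \<and>
        cod2 (presented P) (hcomp (presented P) \<beta> \<alpha>) =
          comp1 (presented P) (cod2 (presented P) \<beta>) (cod2 (presented P) \<alpha>)"
      using a b ab ta tb by (simp add: Cell_presented)
    fix \<gamma> assume "\<gamma> \<in> Cell (presented P)"
      "tgt (presented P) (dom2 (presented P) \<beta>) = src (presented P) (dom2 (presented P) \<gamma>)"
    with b obtain c where c: "\<gamma> = cell_of P c" "wf_cell P c" "cell_tgt P b = cell_src P c"
      by (auto simp: Cell_presented)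
    show "hcomp (presented P) \<gamma> (hcomp (presented P) \<beta> \<alpha>) =
        hcomp (presented P) (hcomp (presented P) \<gamma> \<beta>) \<alpha>"
      using a b c ab ceq.horz_assoc[OF ra, of "cell_tgt P b" _ _ b "cell_tgt P c" _ _ c]
        ceq_refl[OF b(2)] ceq_refl[OF c(2)]
      by (auto intro!: cell_of_cong)
  }
  {
    assume "cod2 (presented P) \<alpha> = dom2 (presented P) \<beta>"
    with a b have ab: "mor_of P (cell_cod P a) = mor_of P (cell_dom P b)" by simp
    with a b have wab: "wf_cell P (CVert b a)" by (subst wf_cell_CVert_iff)
    show "vcomp (presented P) \<beta> \<alpha> \<in> Cell (presented P) \<and>
        dom2 (presented P) (vcomp (presented P) \<beta> \<alpha>) = dom2 (presented P) \<alpha> \<and>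
        cod2 (presented P) (vcomp (presented P) \<beta> \<alpha>) = cod2 (presented P) \<beta>"
      using a b wab by (simp add: Cell_presented del: wf_cell.simps(3))
    let ?x = "cell_src P a" and ?y = "cell_tgt P a"
    have m: "meq P ?x ?y (cell_cod P a) (cell_dom P b)" using wab by simp
    have xy: "cell_src P b = ?x" "cell_tgt P b = ?y" using meq_typed[OF m] by auto
    \<comment> \<open>Reflexivity of \<open>b\<close> with the codomain of \<open>a\<close> written
      as its domain: \<open>vert_assoc\<close> and \<open>interchange\<close> require literally
      equal middle terms.\<close>
    have rb: "ceq P ?x ?y (cell_cod P a) (cell_cod P b) b b"
      using ceq.conv[OF ceq_refl[OF b(2)]] m xy tb by (auto intro: meq.sym meq_refl')
    fix \<gamma> assume g: "\<gamma> \<in> Cell (presented P)"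
    {
      assume "cod2 (presented P) \<beta> = dom2 (presented P) \<gamma>"
      with b g obtain c where c: "\<gamma> = cell_of P c" "wf_cell P c" and
        bc: "mor_of P (cell_cod P b) = mor_of P (cell_dom P c)"
        by (auto simp: Cell_presented)
      with b have wbc: "wf_cell P (CVert c b)" by (subst wf_cell_CVert_iff)
      have w: "wf_cell P (CVert c (CVert b a))" "wf_cell P (CVert (CVert c b) a)"
        using a b c ab bc wab wbc
        by (subst wf_cell_CVert_iff; simp del: wf_cell.simps(3))+
      have m': "meq P ?x ?y (cell_cod P b) (cell_dom P c)" using wbc xy by simp
      have xy': "cell_src P c = ?x" "cell_tgt P c = ?y" using meq_typed[OF m'] by auto
      have rc: "ceq P ?x ?y (cell_cod P b) (cell_cod P c) c c"
        using ceq.conv[OF ceq_refl[OF c(2)]] m' xy' wf_cell_typed[OF c(2)]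
        by (auto intro: meq.sym meq_refl')
      show "vcomp (presented P) \<gamma> (vcomp (presented P) \<beta> \<alpha>) =
          vcomp (presented P) (vcomp (presented P) \<gamma> \<beta>) \<alpha>"
        using a b c wab wbc w cell_of_cong[OF ceq.vert_assoc[OF ra rb rc]]
        by (simp del: wf_cell.simps(3))
    }
    fix \<delta> assume d: "\<delta> \<in> Cell (presented P)" and cd: "cod2 (presented P) \<gamma> = dom2 (presented P) \<delta>"
      and ac: "tgt (presented P) (dom2 (presented P) \<alpha>) = src (presented P) (dom2 (presented P) \<gamma>)"
    from g obtain c where c: "\<gamma> = cell_of P c" "wf_cell P c" by (auto simp: Cell_presented)
    from d obtain e where e: "\<delta> = cell_of P e" "wf_cell P e" by (auto simp: Cell_presented)
    have wce: "wf_cell P (CVert e c)" using c e cd by (subst wf_cell_CVert_iff) auto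
    have z: "cell_src P c = ?y" using ac a c by simp
    let ?z = "cell_tgt P c"
    have m': "meq P ?y ?z (cell_cod P c) (cell_dom P e)" using wce z by simp
    have xy': "cell_src P e = ?y" "cell_tgt P e = ?z" using meq_typed[OF m'] by auto
    have rc: "ceq P ?y ?z (cell_dom P c) (cell_cod P c) c c" using ceq_refl[OF c(2)] z by simp
    have re: "ceq P ?y ?z (cell_cod P c) (cell_cod P e) e e"
      using ceq.conv[OF ceq_refl[OF e(2)]] m' xy' wf_cell_typed[OF e(2)]
      by (auto intro: meq.sym meq_refl')
    have *: "ceq P ?x ?z (MComp (cell_dom P c) (cell_dom P a)) (MComp (cell_cod P e) (cell_cod P b))
        (CHorz (CVert e c) (CVert b a)) (CVert (CHorz e b) (CHorz c a))"
      by (rule ceq.interchange[OF ra rb rc re])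
    have w: "wf_cell P (CHorz (CVert e c) (CVert b a))" "wf_cell P (CVert (CHorz e b) (CHorz c a))"
      "wf_cell P (CHorz e b)" "wf_cell P (CHorz c a)"
      using ceq_typed[OF *] by auto
    show "hcomp (presented P) (vcomp (presented P) \<delta> \<gamma>) (vcomp (presented P) \<beta> \<alpha>) =
        vcomp (presented P) (hcomp (presented P) \<delta> \<beta>) (hcomp (presented P) \<gamma> \<alpha>)"
      using a b c e wab wce w cell_of_cong[OF *]
      by (simp del: wf_cell.simps(3,4))
  }
qed


section \<open>Isomorphisms of categories\<close>

text \<open>The inverse is built from \<open>inv_into\<close>. Its values outside the carriers are
  arbitrary, which is harmless since \<open>cat_iso\<close> tests the round trips on carriers
  only.\<close>

lemma cat_isoI:
  assumes F: "is_functor C D F"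
    and ob: "bij_betw (cfob F) (Obj C) (Obj D)"
    and arr: "bij_betw (cfarr F) (Arr C) (Arr D)"
  shows "cat_iso C D F"
proof -
  interpret F: is_functor C D F by (rule F)
  define G where "G = \<lparr>cfob = inv_into (Obj C) (cfob F), cfarr = inv_into (Arr C) (cfarr F)\<rparr>"
  have Gob: "cfob G y \<in> Obj C" "cfob F (cfob G y) = y" if "y \<in> Obj D" for y
    using that ob by (auto simp: G_def bij_betw_def inv_into_into f_inv_into_f)
  have Garr: "cfarr G v \<in> Arr C" "cfarr F (cfarr G v) = v" if "v \<in> Arr D" for v
    using that arr by (auto simp: G_def bij_betw_def inv_into_into f_inv_into_f)
  have Fob: "cfob G (cfob F x) = x" if "x \<in> Obj C" for x
    using that ob by (simp add: G_def bij_betw_def)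
  have Farr: "cfarr G (cfarr F u) = u" if "u \<in> Arr C" for u
    using that arr by (simp add: G_def bij_betw_def)
  have Gdom: "cdom C (cfarr G v) = cfob G (cdom D v)" "ccod C (cfarr G v) = cfob G (ccod D v)"
    if "v \<in> Arr D" for v
    using Garr[OF that] F.arr Fob F.source.dom_ob F.source.cod_ob by metis+
  have "is_functor D C G"
  proof
    fix y assume y: "y \<in> Obj D"
    then show "cfob G y \<in> Obj C" by (rule Gob)
    show "cfarr G (cid D y) = cid C (cfob G y)"
      using Gob[OF y] F.id F.source.id_arr Farr by metis
  next
    fix v assume "v \<in> Arr D"
    then show "cfarr G v \<in> Arr C \<and> cdom C (cfarr G v) = cfob G (cdom D v) \<and>
        ccod C (cfarr G v) = cfob G (ccod D v)"
      using Garr Gdom by blast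
  next
    fix u v assume uv: "u \<in> Arr D" "v \<in> Arr D" "ccod D u = cdom D v"
    then have "ccod C (cfarr G u) = cdom C (cfarr G v)" by (simp add: Gdom)
    then show "cfarr G (ccomp D v u) = ccomp C (cfarr G v) (cfarr G u)"
      using uv Garr F.comp F.source.comp_arr Farr by metis
  qed
  then show ?thesis
    unfolding cat_iso_def using F Fob Farr Gob Garr by blast
qed

text \<open>The inverse functor recovers both objects from the same point \<open>()\<close>. This
  refutes 2-terminality as soon as two different morphisms are exhibited.\<close>

lemma isomorphic_terminal_cat_unique:
  fixes C :: "('o, 'a) cat"
  assumes "isomorphic_cats C terminal_cat" "x \<in> Obj C" "y \<in> Obj C"
  shows "x = y"
proof -
  obtain F :: "('o, 'a, unit, unit) cfun" and G :: "(unit, unit, 'o, 'a) cfun"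
    where "\<forall>x\<in>Obj C. cfob G (cfob F x) = x"
    using assms(1) unfolding isomorphic_cats_def cat_iso_def by blast
  then show ?thesis using assms(2,3) by (metis old.unit.exhaust)
qed

section \<open>Typing and unit laws as rewrite rules\<close>

context two_category
begin

lemma mor_simps [simp]:
  "f \<in> Mor A \<Longrightarrow> src A f \<in> Ob A"
  "f \<in> Mor A \<Longrightarrow> tgt A f \<in> Ob A"
  "X \<in> Ob A \<Longrightarrow> id1 A X \<in> Mor A"
  "X \<in> Ob A \<Longrightarrow> src A (id1 A X) = X"
  "X \<in> Ob A \<Longrightarrow> tgt A (id1 A X) = X"
  "\<lbrakk>f \<in> Mor A; g \<in> Mor A; tgt A f = src A g\<rbrakk> \<Longrightarrow> g \<odot> f \<in> Mor A"
  "\<lbrakk>f \<in> Mor A; g \<in> Mor A; tgt A f = src A g\<rbrakk> \<Longrightarrow> src A (g \<odot> f) = src A f"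
  "\<lbrakk>f \<in> Mor A; g \<in> Mor A; tgt A f = src A g\<rbrakk> \<Longrightarrow> tgt A (g \<odot> f) = tgt A g"
  "\<lbrakk>f \<in> Mor A; tgt A f = Y\<rbrakk> \<Longrightarrow> id1 A Y \<odot> f = f"
  "\<lbrakk>f \<in> Mor A; src A f = X\<rbrakk> \<Longrightarrow> f \<odot> id1 A X = f"
  using mor_typed id1_typed comp1_typed comp1_id_left comp1_id_right by auto

lemma cell_simps [simp]:
  "a \<in> Cell A \<Longrightarrow> dom2 A a \<in> Mor A"
  "a \<in> Cell A \<Longrightarrow> cod2 A a \<in> Mor A"
  "a \<in> Cell A \<Longrightarrow> src A (cod2 A a) = src A (dom2 A a)"
  "a \<in> Cell A \<Longrightarrow> tgt A (cod2 A a) = tgt A (dom2 A a)"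
  "f \<in> Mor A \<Longrightarrow> id2 A f \<in> Cell A"
  "f \<in> Mor A \<Longrightarrow> dom2 A (id2 A f) = f"
  "f \<in> Mor A \<Longrightarrow> cod2 A (id2 A f) = f"
  "\<lbrakk>a \<in> Cell A; b \<in> Cell A; cod2 A a = dom2 A b\<rbrakk> \<Longrightarrow> b \<cdot> a \<in> Cell A"
  "\<lbrakk>a \<in> Cell A; b \<in> Cell A; cod2 A a = dom2 A b\<rbrakk> \<Longrightarrow> dom2 A (b \<cdot> a) = dom2 A a"
  "\<lbrakk>a \<in> Cell A; b \<in> Cell A; cod2 A a = dom2 A b\<rbrakk> \<Longrightarrow> cod2 A (b \<cdot> a) = cod2 A b"
  "\<lbrakk>a \<in> Cell A; b \<in> Cell A; tgt A (dom2 A a) = src A (dom2 A b)\<rbrakk> \<Longrightarrow> b \<star> a \<in> Cell A"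
  "\<lbrakk>a \<in> Cell A; b \<in> Cell A; tgt A (dom2 A a) = src A (dom2 A b)\<rbrakk> \<Longrightarrow>
     dom2 A (b \<star> a) = dom2 A b \<odot> dom2 A a"
  "\<lbrakk>a \<in> Cell A; b \<in> Cell A; tgt A (dom2 A a) = src A (dom2 A b)\<rbrakk> \<Longrightarrow>
     cod2 A (b \<star> a) = cod2 A b \<odot> cod2 A a"
  "\<lbrakk>a \<in> Cell A; cod2 A a = f\<rbrakk> \<Longrightarrow> id2 A f \<cdot> a = a"
  "\<lbrakk>a \<in> Cell A; dom2 A a = f\<rbrakk> \<Longrightarrow> a \<cdot> id2 A f = a"
  "\<lbrakk>f \<in> Mor A; g \<in> Mor A; tgt A f = src A g\<rbrakk> \<Longrightarrow> id2 A g \<star> id2 A f = id2 A (g \<odot> f)"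
  using cell_typed id2_typed vcomp_typed hcomp_typed vcomp_id_left vcomp_id_right hcomp_id2 by metis+

lemma category_hom_cat: "category (hom_cat A X Y)"
  by unfold_locales
    (auto simp: hom_cat_def vcomp_assoc)

end


section \<open>Pseudo-limits in locally posetal 2-categories\<close>

locale posetal_two_category = two_category A
  for A :: "('o, 'm, 'c) two_cat" (structure) +
  assumes thin: "\<lbrakk>a \<in> Cell A; b \<in> Cell A; dom2 A a = dom2 A b; cod2 A a = cod2 A b\<rbrakk> \<Longrightarrow> a = b"
    and antisym: "\<lbrakk>a \<in> Cell A; b \<in> Cell A; dom2 A b = cod2 A a; cod2 A b = dom2 A a\<rbrakk> \<Longrightarrow>
      dom2 A a = cod2 A a"
begin

lemma invertible2_id2: "f \<in> Mor A \<Longrightarrow> invertible2 A (id2 A f)"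
  unfolding invertible2_def by (metis id2_typed vcomp_id_left)

text \<open>The inverse runs in the opposite direction, so \<open>antisym\<close> equates domain and
  codomain; then \<open>thin\<close> leaves only the identity.\<close>

lemma invertible2_imp_id2:
  assumes "invertible2 A a"
  shows "dom2 A a = cod2 A a" "a = id2 A (cod2 A a)"
proof -
  obtain b where "a \<in> Cell A" "b \<in> Cell A" "dom2 A b = cod2 A a" "cod2 A b = dom2 A a"
    using assms unfolding invertible2_def by blast
  then show "dom2 A a = cod2 A a" by (rule antisym)
  with \<open>a \<in> Cell A\<close> show "a = id2 A (cod2 A a)" by (intro thin) simp_all
qed

end

section \<open>Strict transformations and their modifications\<close>

locale posetal_diagrams = I: two_category I + posetal_two_category A
  for I :: "('i, 'u, 's) two_cat" and A :: "('o, 'm, 'c) two_cat" (structure)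
begin

text \<open>Every coherence law equates two parallel 2-morphisms, so \<open>thin\<close> reduces it
  to a comparison of boundaries, and these agree by \<open>strict\<close>.\<close>

lemma strict_pseudo_natI:
  assumes F: "two_functor I A (psrc \<mu>)" and G: "two_functor I A (ptgt \<mu>)"
    and ext: "pob \<mu> \<in> extensional (Ob I)" "pmor \<mu> \<in> extensional (Mor I)"
    and ob: "\<And>i. i \<in> Ob I \<Longrightarrow> pob \<mu> i \<in> Mor A"
      "\<And>i. i \<in> Ob I \<Longrightarrow> src A (pob \<mu> i) = fob (psrc \<mu>) i"
      "\<And>i. i \<in> Ob I \<Longrightarrow> tgt A (pob \<mu> i) = fob (ptgt \<mu>) i"
    and strict: "\<And>u. u \<in> Mor I \<Longrightarrow>
      fmor (ptgt \<mu>) u \<odot> pob \<mu> (src I u) = pob \<mu> (tgt I u) \<odot> fmor (psrc \<mu>) u"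
    and pmor: "\<And>u. u \<in> Mor I \<Longrightarrow> pmor \<mu> u = id2 A (pob \<mu> (tgt I u) \<odot> fmor (psrc \<mu>) u)"
  shows "pseudo_nat I A \<mu>"
proof -
  interpret F: two_functor I A "psrc \<mu>" by (rule F)
  interpret G: two_functor I A "ptgt \<mu>" by (rule G)
  note [simp] = ob F.ob G.ob F.mor G.mor F.cell G.cell
  show ?thesis
  proof
    show "pob \<mu> \<in> extensional (Ob I)" "pmor \<mu> \<in> extensional (Mor I)" by fact+
  next
    fix i assume i: "i \<in> Ob I"
    then show "pob \<mu> i \<in> Mor A \<and> src A (pob \<mu> i) = fob (psrc \<mu>) i \<and> tgt A (pob \<mu> i) = fob (ptgt \<mu>) i"
      by simp
    show "pmor \<mu> (id1 I i) = id2 A (pob \<mu> i)"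
      using i by (simp add: pmor F.id1)
  next
    fix u assume u: "u \<in> Mor I"
    then show "invertible2 A (pmor \<mu> u) \<and>
      dom2 A (pmor \<mu> u) = fmor (ptgt \<mu>) u \<odot> pob \<mu> (src I u) \<and>
      cod2 A (pmor \<mu> u) = pob \<mu> (tgt I u) \<odot> fmor (psrc \<mu>) u"
      by (simp add: pmor invertible2_id2 strict)
    fix v assume v: "v \<in> Mor I" "tgt I u = src I v"
    \<comment> \<open>The two whiskered identities in the composition law meet at this morphism; the
      equation makes them composable.\<close>
    have "fmor (ptgt \<mu>) v \<odot> (pob \<mu> (tgt I u) \<odot> fmor (psrc \<mu>) u) =
        (pob \<mu> (tgt I v) \<odot> fmor (psrc \<mu>) v) \<odot> fmor (psrc \<mu>) u"
      using u v strict[OF v(1)] by (simp add: comp1_assoc)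
    then show "pmor \<mu> (v \<odot>\<^bsub>I\<^esub> u) =
        (pmor \<mu> v \<star> id2 A (fmor (psrc \<mu>) u)) \<cdot> (id2 A (fmor (ptgt \<mu>) v) \<star> pmor \<mu> u)"
      using u v by (intro thin) (simp_all add: pmor F.comp1 comp1_assoc)
  next
    fix s assume s: "s \<in> Cell I"
    show "pmor \<mu> (cod2 I s) \<cdot> (fcell (ptgt \<mu>) s \<star> id2 A (pob \<mu> (src I (dom2 I s)))) =
      (id2 A (pob \<mu> (tgt I (dom2 I s))) \<star> fcell (psrc \<mu>) s) \<cdot> pmor \<mu> (dom2 I s)"
      using s strict[of "dom2 I s"] strict[of "cod2 I s"] by (intro thin) (simp_all add: pmor)
  qed
qed

lemma pseudo_nat_strict:
  assumes "pseudo_nat I A \<mu>" and u: "u \<in> Mor I"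
  shows "fmor (ptgt \<mu>) u \<odot> pob \<mu> (src I u) = pob \<mu> (tgt I u) \<odot> fmor (psrc \<mu>) u"
    and "pmor \<mu> u = id2 A (pob \<mu> (tgt I u) \<odot> fmor (psrc \<mu>) u)"
proof -
  interpret pseudo_nat I A \<mu> by fact
  show "fmor (ptgt \<mu>) u \<odot> pob \<mu> (src I u) = pob \<mu> (tgt I u) \<odot> fmor (psrc \<mu>) u"
    "pmor \<mu> u = id2 A (pob \<mu> (tgt I u) \<odot> fmor (psrc \<mu>) u)"
    using mor[OF u] invertible2_imp_id2[of "pmor \<mu> u"] by simp_all
qed

text \<open>The 2-morphism components are identities on morphisms expressed through
  \<open>pob\<close>, so they add no freedom.\<close>

lemma pseudo_nat_eqI:
  assumes \<mu>: "pseudo_nat I A \<mu>" and \<nu>: "pseudo_nat I A \<nu>"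
    and "psrc \<mu> = psrc \<nu>" "ptgt \<mu> = ptgt \<nu>"
    and pob: "\<And>i. i \<in> Ob I \<Longrightarrow> pob \<mu> i = pob \<nu> i"
  shows "\<mu> = \<nu>"
proof -
  have "pob \<mu> = pob \<nu>"
    using pseudo_nat.ext(1)[OF \<mu>] pseudo_nat.ext(1)[OF \<nu>] pob by (rule extensionalityI)
  moreover have "pmor \<mu> = pmor \<nu>"
    using pseudo_nat.ext(2)[OF \<mu>] pseudo_nat.ext(2)[OF \<nu>]
    by (rule extensionalityI) (simp add: pseudo_nat_strict(2)[OF \<mu>] pseudo_nat_strict(2)[OF \<nu>] pob assms(3))
  ultimately show ?thesis using assms(3,4) by (intro psnat.equality) simp_all
qed

lemma modificationI:
  assumes \<mu>: "pseudo_nat I A (mdom \<phi>)" and \<nu>: "pseudo_nat I A (mcod \<phi>)"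
    and par: "psrc (mdom \<phi>) = psrc (mcod \<phi>)" "ptgt (mdom \<phi>) = ptgt (mcod \<phi>)"
    and ext: "mob \<phi> \<in> extensional (Ob I)"
    and ob: "\<And>i. i \<in> Ob I \<Longrightarrow> mob \<phi> i \<in> Cell A"
      "\<And>i. i \<in> Ob I \<Longrightarrow> dom2 A (mob \<phi> i) = pob (mdom \<phi>) i"
      "\<And>i. i \<in> Ob I \<Longrightarrow> cod2 A (mob \<phi> i) = pob (mcod \<phi>) i"
  shows "modification I A \<phi>"
proof -
  interpret \<mu>: pseudo_nat I A "mdom \<phi>" by (rule \<mu>)
  interpret \<nu>: pseudo_nat I A "mcod \<phi>" by (rule \<nu>)
  note [simp] = ob \<mu>.ob \<nu>.ob \<mu>.source.ob \<mu>.target.ob \<nu>.source.ob \<nu>.target.ob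
    \<mu>.source.mor \<mu>.target.mor \<nu>.source.mor \<nu>.target.mor
  show ?thesis
  proof
    fix u assume u: "u \<in> Mor I"
    note s = pseudo_nat_strict[OF \<mu> u] pseudo_nat_strict[OF \<nu> u]
    show "pmor (mcod \<phi>) u \<cdot> (id2 A (fmor (ptgt (mdom \<phi>)) u) \<star> mob \<phi> (src I u)) =
      (mob \<phi> (tgt I u) \<star> id2 A (fmor (psrc (mdom \<phi>)) u)) \<cdot> pmor (mdom \<phi>) u"
      using u s(1,3) by (intro thin) (simp_all add: s(2,4) par)
  qed (use par ext in auto)
qed

text \<open>Components with equal boundary coincide by \<open>thin\<close>. The category and functor
  laws for modifications below are discharged this way.\<close>

lemma modification_eqI:
  assumes \<phi>: "modification I A \<phi>" and \<psi>: "modification I A \<psi>"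
    and "mdom \<phi> = mdom \<psi>" "mcod \<phi> = mcod \<psi>"
  shows "\<phi> = \<psi>"
proof -
  interpret \<phi>: modification I A \<phi> by (rule \<phi>)
  interpret \<psi>: modification I A \<psi> by (rule \<psi>)
  have "mob \<phi> = mob \<psi>"
    using \<phi>.ext \<psi>.ext
    by (rule extensionalityI) (rule thin; use \<phi>.ob \<psi>.ob assms in simp)
  then show ?thesis using assms by (intro modif.equality) simp_all
qed

lemma modification_id2:
  assumes \<mu>: "pseudo_nat I A \<mu>"
  shows "modification I A (id2 (Ps I A) \<mu>)"
  using pseudo_nat.ob[OF \<mu>] \<mu> by (intro modificationI) (simp_all add: Ps_def)

lemma modification_vcomp:
  assumes \<phi>: "modification I A \<phi>" and \<psi>: "modification I A \<psi>" and "mcod \<phi> = mdom \<psi>"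
  shows "modification I A (\<psi> \<cdot>\<^bsub>Ps I A\<^esub> \<phi>)"
proof -
  interpret \<phi>: modification I A \<phi> by (rule \<phi>)
  interpret \<psi>: modification I A \<psi> by (rule \<psi>)
  note [simp] = \<phi>.ob \<psi>.ob
  show ?thesis
    by (rule modificationI)
      (use assms \<phi>.source.pseudo_nat_axioms \<psi>.target.pseudo_nat_axioms \<phi>.parallel \<psi>.parallel
        in \<open>simp_all add: Ps_def\<close>)
qed

lemma Ps_simps [simp]:
  "Ob (Ps I A) = Collect (two_functor I A)"
  "Mor (Ps I A) = Collect (pseudo_nat I A)"
  "Cell (Ps I A) = Collect (modification I A)"
  "src (Ps I A) = psrc" "tgt (Ps I A) = ptgt" "dom2 (Ps I A) = mdom" "cod2 (Ps I A) = mcod"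
  "mdom (id2 (Ps I A) \<mu>) = \<mu>" "mcod (id2 (Ps I A) \<mu>) = \<mu>"
  "mdom (\<psi> \<cdot>\<^bsub>Ps I A\<^esub> \<phi>) = mdom \<phi>" "mcod (\<psi> \<cdot>\<^bsub>Ps I A\<^esub> \<phi>) = mcod \<psi>"
  "mdom (\<psi> \<star>\<^bsub>Ps I A\<^esub> \<phi>) = mdom \<psi> \<odot>\<^bsub>Ps I A\<^esub> mdom \<phi>"
  "mcod (\<psi> \<star>\<^bsub>Ps I A\<^esub> \<phi>) = mcod \<psi> \<odot>\<^bsub>Ps I A\<^esub> mcod \<phi>"
  by (simp_all add: Ps_def)

lemma category_hom_cat_Ps: "category (hom_cat (Ps I A) G F)"
proof -
  have par: "pseudo_nat I A (mdom \<phi>)" "pseudo_nat I A (mcod \<phi>)"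
    "psrc (mcod \<phi>) = psrc (mdom \<phi>)" "ptgt (mcod \<phi>) = ptgt (mdom \<phi>)"
    if "modification I A \<phi>" for \<phi>
    using that unfolding modification_def modification_axioms_def by auto
  show ?thesis
    by unfold_locales
      (auto simp: hom_cat_def par modification_id2 modification_vcomp intro!: modification_eqI)
qed

section \<open>Constant diagrams and whiskering of a cone\<close>

lemma const_ob_simps [simp]:
  "i \<in> Ob I \<Longrightarrow> fob (const_ob I A X) i = X"
  "u \<in> Mor I \<Longrightarrow> fmor (const_ob I A X) u = id1 A X"
  by (simp_all add: const_ob_def)

lemma two_functor_const_ob: "X \<in> Ob A \<Longrightarrow> two_functor I A (const_ob I A X)"
  by unfold_locales (auto simp: const_ob_def)

lemma whisker_cone_simps [simp]:
  "psrc (l \<odot>\<^bsub>Ps I A\<^esub> const_mor I A f) = const_ob I A (src A f)"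
  "ptgt (l \<odot>\<^bsub>Ps I A\<^esub> const_mor I A f) = ptgt l"
  "i \<in> Ob I \<Longrightarrow> pob (l \<odot>\<^bsub>Ps I A\<^esub> const_mor I A f) i = pob l i \<odot> f"
  by (simp_all add: Ps_def psnat_comp_def const_mor_def)

lemma pseudo_nat_whisker_cone:
  assumes l: "pseudo_nat I A l" "psrc l = const_ob I A L"
    and f: "f \<in> Mor A" "tgt A f = L"
  shows "pseudo_nat I A (l \<odot>\<^bsub>Ps I A\<^esub> const_mor I A f)"
proof -
  interpret l: pseudo_nat I A l by fact
  have [simp]: "src A (pob l i) = L" if "i \<in> Ob I" for i
    using l.ob[OF that] that by (simp add: l(2))
  note [simp] = l.ob l.target.ob l.target.mor
  \<comment> \<open>The source of \<open>l\<close> is constant, so the identity on the right drops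
    out of the strictness equation.\<close>
  have *: "fmor (ptgt l) u \<odot> pob l (src I u) = pob l (tgt I u)" if "u \<in> Mor I" for u
    using pseudo_nat_strict(1)[OF l(1) that] that f by (simp add: l(2))
  show ?thesis
  proof (rule strict_pseudo_natI)
    fix u assume u: "u \<in> Mor I"
    show "fmor (ptgt (l \<odot>\<^bsub>Ps I A\<^esub> const_mor I A f)) u \<odot> pob (l \<odot>\<^bsub>Ps I A\<^esub> const_mor I A f) (src I u) =
        pob (l \<odot>\<^bsub>Ps I A\<^esub> const_mor I A f) (tgt I u) \<odot> fmor (psrc (l \<odot>\<^bsub>Ps I A\<^esub> const_mor I A f)) u"
      using u f by (simp add: comp1_assoc *)
    show "pmor (l \<odot>\<^bsub>Ps I A\<^esub> const_mor I A f) u = id2 A (pob (l \<odot>\<^bsub>Ps I A\<^esub> const_mor I A f) (tgt I u) \<odot>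
        fmor (psrc (l \<odot>\<^bsub>Ps I A\<^esub> const_mor I A f)) u)"
      using u f pseudo_nat_strict(2)[OF l(1) u]
      by (simp add: Ps_def psnat_comp_def const_mor_def l(2))
  qed (use f l.target.two_functor_axioms in
      \<open>simp_all add: two_functor_const_ob, simp_all add: Ps_def psnat_comp_def\<close>)
qed

lemma const_cell_simps [simp]:
  "mdom (const_cell I A a) = const_mor I A (dom2 A a)"
  "mcod (const_cell I A a) = const_mor I A (cod2 A a)"
  by (simp_all add: const_cell_def)

lemma modification_whisker_cone:
  assumes l: "pseudo_nat I A l" "psrc l = const_ob I A L"
    and a: "a \<in> Cell A" "tgt A (dom2 A a) = L"
  shows "modification I A (id2 (Ps I A) l \<star>\<^bsub>Ps I A\<^esub> const_cell I A a)"
proof -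
  interpret l: pseudo_nat I A l by fact
  have [simp]: "src A (pob l i) = L" if "i \<in> Ob I" for i
    using l.ob[OF that] that by (simp add: l(2))
  note [simp] = l.ob
  have m: "mob (id2 (Ps I A) l \<star>\<^bsub>Ps I A\<^esub> const_cell I A a) = (\<lambda>i\<in>Ob I. id2 A (pob l i) \<star> a)"
    by (auto simp: Ps_def const_cell_def)
  show ?thesis
    by (rule modificationI)
      (use a in \<open>simp_all add: m pseudo_nat_whisker_cone[OF l]\<close>)
qed

lemma is_functor_postcomp_const:
  assumes l: "pseudo_nat I A l" "psrc l = const_ob I A L"
  shows "is_functor (hom_cat A X L) (hom_cat (Ps I A) (const_ob I A X) (ptgt l)) (postcomp_const I A l)"
proof -
  interpret C: category "hom_cat A X L" by (rule category_hom_cat)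
  interpret D: category "hom_cat (Ps I A) (const_ob I A X) (ptgt l)" by (rule category_hom_cat_Ps)
  note w = pseudo_nat_whisker_cone[OF l] modification_whisker_cone[OF l]
  show ?thesis
    by unfold_locales
      (auto simp: hom_cat_def postcomp_const_def w modification_id2 modification_vcomp
        intro!: modification_eqI)
qed

text \<open>In a locally posetal 2-category pseudo-cones are strict, and a modification is a pointwise
  inequality; so only factorization of cones and reflection of inequalities remain to be checked.\<close>

lemma is_pseudo_limitI:
  assumes l: "pseudo_cone I A F L l"
    and factor: "\<And>X \<mu>. pseudo_cone I A F X \<mu> \<Longrightarrow>
      \<exists>f\<in>Mor A. src A f = X \<and> tgt A f = L \<and> (\<forall>i\<in>Ob I. pob \<mu> i = pob l i \<odot> f)"
    and unique: "\<And>f g. \<lbrakk>f \<in> Mor A; g \<in> Mor A; src A f = src A g; tgt A f = L; tgt A g = L;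
      \<forall>i\<in>Ob I. pob l i \<odot> f = pob l i \<odot> g\<rbrakk> \<Longrightarrow> f = g"
    and full: "\<And>f g. \<lbrakk>f \<in> Mor A; g \<in> Mor A; src A f = src A g; tgt A f = L; tgt A g = L;
      \<forall>i\<in>Ob I. \<exists>a\<in>Cell A. dom2 A a = pob l i \<odot> f \<and> cod2 A a = pob l i \<odot> g\<rbrakk> \<Longrightarrow>
      \<exists>a\<in>Cell A. dom2 A a = f \<and> cod2 A a = g"
  shows "is_pseudo_limit I A F (L, l)"
proof -
  have l': "pseudo_nat I A l" "psrc l = const_ob I A L" "ptgt l = F" "L \<in> Ob A"
    using l by (auto simp: pseudo_cone_def)
  let ?\<Phi> = "postcomp_const I A l"
  have "cat_iso (hom_cat A X L) (hom_cat (Ps I A) (const_ob I A X) F) ?\<Phi>" if X: "X \<in> Ob A" for X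
  proof -
    let ?C = "hom_cat A X L" and ?D = "hom_cat (Ps I A) (const_ob I A X) F"
    interpret \<Phi>: is_functor ?C ?D ?\<Phi>
      using is_functor_postcomp_const[OF l'(1,2)] l'(3) by simp
    have pob: "pob (cfob ?\<Phi> f) i = pob l i \<odot> f" if "i \<in> Ob I" for f i
      using that by (simp add: postcomp_const_def)
    have inj: "f = g" if "f \<in> Obj ?C" "g \<in> Obj ?C" "cfob ?\<Phi> f = cfob ?\<Phi> g" for f g
    proof -
      have "\<forall>i\<in>Ob I. pob l i \<odot> f = pob l i \<odot> g" using pob that(3) by metis
      then show ?thesis using that by (intro unique) (auto simp: hom_cat_def)
    qed
    have surj: "\<exists>f\<in>Obj ?C. \<mu> = cfob ?\<Phi> f" if \<mu>: "\<mu> \<in> Obj ?D" for \<mu>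
    proof -
      have "pseudo_cone I A F X \<mu>" using \<mu> X by (simp add: hom_cat_def pseudo_cone_def)
      from factor[OF this] obtain f where f: "f \<in> Obj ?C" "\<forall>i\<in>Ob I. pob \<mu> i = pob l i \<odot> f"
        by (auto simp: hom_cat_def)
      have "\<mu> = cfob ?\<Phi> f"
        by (rule pseudo_nat_eqI) (use \<Phi>.ob[OF f(1)] \<mu> f in \<open>auto simp: hom_cat_def pob\<close>)
      with f show ?thesis by blast
    qed
    \<comment> \<open>By \<open>thin\<close> only the boundaries have to be compared, and these
      agree by injectivity on objects.\<close>
    have inj_arr: "a = b" if ab: "a \<in> Arr ?C" "b \<in> Arr ?C" "cfarr ?\<Phi> a = cfarr ?\<Phi> b" for a b
    proof -
      have "cfob ?\<Phi> (dom2 A a) = cfob ?\<Phi> (dom2 A b)" "cfob ?\<Phi> (cod2 A a) = cfob ?\<Phi> (cod2 A b)"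
        using \<Phi>.arr[OF ab(1)] \<Phi>.arr[OF ab(2)] ab(3) by (simp_all add: hom_cat_def)
      then show ?thesis
        using ab \<Phi>.source.dom_ob \<Phi>.source.cod_ob
        by (intro thin inj) (auto simp: hom_cat_def)
    qed
    have surj_arr: "\<exists>a\<in>Arr ?C. \<phi> = cfarr ?\<Phi> a" if \<phi>: "\<phi> \<in> Arr ?D" for \<phi>
    proof -
      obtain f g where f: "f \<in> Obj ?C" "mdom \<phi> = cfob ?\<Phi> f" and g: "g \<in> Obj ?C" "mcod \<phi> = cfob ?\<Phi> g"
        using surj[OF \<Phi>.target.dom_ob[OF \<phi>]] surj[OF \<Phi>.target.cod_ob[OF \<phi>]]
        by (auto simp: hom_cat_def)
      interpret \<phi>: modification I A \<phi> using \<phi> by (simp add: hom_cat_def)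
      \<comment> \<open>The components of \<open>\<phi>\<close> are the family of 2-morphisms that
        \<open>full\<close> asks for.\<close>
      have "\<exists>a\<in>Cell A. dom2 A a = pob l i \<odot> f \<and> cod2 A a = pob l i \<odot> g" if "i \<in> Ob I" for i
        using \<phi>.ob[OF that] that by (auto simp: f g pob)
      with f g obtain a where a: "a \<in> Cell A" "dom2 A a = f" "cod2 A a = g"
        using full[of f g] by (auto simp: hom_cat_def)
      with f have aC: "a \<in> Arr ?C" by (auto simp: hom_cat_def)
      have "\<phi> = cfarr ?\<Phi> a"
        by (rule modification_eqI)
          (use \<Phi>.arr[OF aC] \<phi> a f g in \<open>auto simp: hom_cat_def\<close>)
      with aC show ?thesis by blast
    qed
    show ?thesis
    proof (rule cat_isoI)
      show "bij_betw (cfob ?\<Phi>) (Obj ?C) (Obj ?D)"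
        using inj surj \<Phi>.ob unfolding bij_betw_def inj_on_def by blast
      show "bij_betw (cfarr ?\<Phi>) (Arr ?C) (Arr ?D)"
        using inj_arr surj_arr \<Phi>.arr unfolding bij_betw_def inj_on_def by blast
    qed (rule \<Phi>.is_functor_axioms)
  qed
  with l show ?thesis by (simp add: is_pseudo_limit_def)
qed

text \<open>The morphisms \<open>(f, l a)\<close> and \<open>(g, id)\<close> from \<open>(X, l g)\<close> to \<open>(L, l)\<close> differ.\<close>

lemma not_two_terminal_lax_slice:
  assumes l: "pseudo_cone I A F L l"
    and a: "a \<in> Cell A" "tgt A (dom2 A a) = L" "dom2 A a \<noteq> cod2 A a"
  shows "\<not> two_terminal (lax_slice I A F) (L, l)"
proof
  let ?f = "dom2 A a" and ?g = "cod2 A a"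
  let ?X = "src A ?f" and ?\<mu> = "l \<odot>\<^bsub>Ps I A\<^esub> const_mor I A ?g"
  let ?p = "((?X, ?\<mu>), (?f, id2 (Ps I A) l \<star>\<^bsub>Ps I A\<^esub> const_cell I A a), (L, l))"
  let ?q = "((?X, ?\<mu>), (?g, id2 (Ps I A) ?\<mu>), (L, l))"
  have l': "pseudo_nat I A l" "psrc l = const_ob I A L" "ptgt l = F"
    using l by (auto simp: pseudo_cone_def)
  have \<mu>: "pseudo_nat I A ?\<mu>"
    using a by (intro pseudo_nat_whisker_cone[OF l'(1,2)]) simp_all
  then have cone: "pseudo_cone I A F ?X ?\<mu>"
    using a by (simp add: pseudo_cone_def l'(3))
  have "?p \<in> Mor (lax_slice I A F)" "?q \<in> Mor (lax_slice I A F)"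
    using l cone a modification_whisker_cone[OF l'(1,2) a(1,2)] modification_id2[OF \<mu>]
    by (auto simp: lax_slice_def Let_def)
  then have pq: "?p \<in> Obj (hom_cat (lax_slice I A F) (?X, ?\<mu>) (L, l))"
    "?q \<in> Obj (hom_cat (lax_slice I A F) (?X, ?\<mu>) (L, l))"
    by (simp_all add: hom_cat_def lax_slice_def Let_def)
  assume "two_terminal (lax_slice I A F) (L, l)"
  moreover have "(?X, ?\<mu>) \<in> Ob (lax_slice I A F)"
    using cone by (simp add: lax_slice_def Let_def)
  ultimately have "isomorphic_cats (hom_cat (lax_slice I A F) (?X, ?\<mu>) (L, l)) terminal_cat"
    by (simp add: two_terminal_def)
  from isomorphic_terminal_cat_unique[OF this pq] a(3) show False by simp
qed

end


section \<open>The example\<close>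

interpretation ex_A: two_category ex_A
  unfolding ex_A_def by (rule two_category_presented)

lemma Ob_ex_A [simp]: "Ob ex_A = UNIV"
  by (simp add: ex_A_def Ob_presented)

lemma gen_mor_eq_mor_of: "gen_mor P e = mor_of P (MGen e)"
  by (simp add: gen_mor_def mor_of_def)

lemma ex_mor_simps [simp]:
  "ex_mor e \<in> Mor ex_A" "src ex_A (ex_mor e) = ex_src e" "tgt ex_A (ex_mor e) = ex_tgt e"
  by (simp_all add: gen_mor_eq_mor_of ex_A_def Mor_presented) (simp_all add: ex_pres_def)

lemma ex_relation: "ex_mor gc \<odot>\<^bsub>ex_A\<^esub> ex_mor gl1 = ex_mor gb \<odot>\<^bsub>ex_A\<^esub> ex_mor gl0"
proof -
  have "meq ex_pres obL obA (MComp (MGen gb) (MGen gl0)) (MComp (MGen gc) (MGen gl1))"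
    by (rule meq.rel) (auto intro!: meq_refl' simp: ex_pres_def)
  from mor_of_cong[OF this] show ?thesis
    by (simp add: gen_mor_eq_mor_of ex_A_def) (simp add: ex_pres_def)
qed

section \<open>The invariant and the normal forms of morphisms\<close>

primrec term_flag :: "('o, ex_gen) mterm \<Rightarrow> bool" where
  "term_flag (MId x) \<longleftrightarrow> False"
| "term_flag (MGen e) \<longleftrightarrow> e = gg"
| "term_flag (MComp t s) \<longleftrightarrow> term_flag t \<or> term_flag s"

text \<open>Unit and associativity laws keep the set of generators that occur, and the only relation
  involves \<open>gb\<close>, \<open>gl0\<close>, \<open>gc\<close> and \<open>gl1\<close>. So
  \<open>gg\<close> can be neither created nor removed, which keeps \<open>gf\<close> and
  \<open>gg\<close> apart in the quotient.\<close>

lemma meq_flag: "meq ex_pres x y s t \<Longrightarrow> term_flag s = term_flag t"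
  by (induction rule: meq.induct) (auto simp: ex_pres_def)

text \<open>The flag of a morphism tells whether it factors through the generator \<open>g\<close>. It distinguishes
  the two elements of each set of morphisms \<open>X \<rightarrow> Y\<close> with \<open>Y \<noteq> X\<close>; all other sets of
  morphisms have at most one element.\<close>

definition flag :: "(ex_ob, ex_gen) pmorph \<Rightarrow> bool" where
  "flag m \<longleftrightarrow> (\<exists>t\<in>fst (snd m). term_flag t)"

lemma flag_mor_of:
  assumes "wf_term ex_pres t"
  shows "flag (mor_of ex_pres t) \<longleftrightarrow> term_flag t"
proof -
  have "flag (mor_of ex_pres t) \<longleftrightarrow> (\<exists>s. (\<exists>x y. meq ex_pres x y s t) \<and> term_flag s)"
    by (auto simp: flag_def mor_of_def mclass_def)
  then show ?thesis using meq_refl[OF assms] meq_flag by blast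
qed

lemma flag_simps [simp]:
  "\<not> flag (id1 ex_A x)"
  "flag (ex_mor e) \<longleftrightarrow> e = gg"
  "\<lbrakk>m \<in> Mor ex_A; n \<in> Mor ex_A; tgt ex_A m = src ex_A n\<rbrakk> \<Longrightarrow> flag (n \<odot>\<^bsub>ex_A\<^esub> m) \<longleftrightarrow> flag n \<or> flag m"
  by (auto simp: ex_A_def gen_mor_eq_mor_of Mor_presented flag_mor_of)

text \<open>The preorder on objects generated by the generating morphisms.\<close>

definition reachable :: "ex_ob \<Rightarrow> ex_ob \<Rightarrow> bool" where
  "reachable x y \<longleftrightarrow> x = y \<or> x = obX \<or> x = obL \<and> y \<noteq> obX \<or> x \<in> {obB, obC} \<and> y = obA"

text \<open>The unique morphism between objects other than \<open>obX\<close>, whenever there is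
  one. From \<open>obL\<close> to \<open>obA\<close> one of the two identified composites is chosen.
  The last clause is meant for \<open>x = y\<close>; of the other pairs it catches, those with
  \<open>x = obX\<close> are treated in \<open>normal_form\<close> and the rest are excluded by
  \<open>reachable\<close>.\<close>

fun path :: "ex_ob \<Rightarrow> ex_ob \<Rightarrow> (ex_ob, ex_gen) pmorph" where
  "path obL obB = ex_mor gl0"
| "path obL obC = ex_mor gl1"
| "path obL obA = ex_mor gb \<odot>\<^bsub>ex_A\<^esub> ex_mor gl0"
| "path obB obA = ex_mor gb"
| "path obC obA = ex_mor gc"
| "path x y = id1 ex_A x"

text \<open>A morphism from \<open>obX\<close> to another object starts with \<open>gf\<close> or
  \<open>gg\<close> and continues with the unique path out of \<open>obL\<close>; the boolean
  records which of the two it is.\<close>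

definition normal_form :: "ex_ob \<Rightarrow> ex_ob \<Rightarrow> bool \<Rightarrow> (ex_ob, ex_gen) pmorph" where
  "normal_form x y b =
     (if x = obX \<and> y \<noteq> obX then path obL y \<odot>\<^bsub>ex_A\<^esub> ex_mor (if b then gg else gf) else path x y)"

lemma path_typed:
  "\<lbrakk>reachable x y; x \<noteq> obX\<rbrakk> \<Longrightarrow>
     path x y \<in> Mor ex_A \<and> src ex_A (path x y) = x \<and> tgt ex_A (path x y) = y \<and> \<not> flag (path x y)"
  by (cases x; cases y) (auto simp: reachable_def)

lemma path_comp:
  "\<lbrakk>reachable x y; reachable y z; x \<noteq> obX\<rbrakk> \<Longrightarrow> path y z \<odot>\<^bsub>ex_A\<^esub> path x y = path x z"
  by (cases x; cases y; cases z) (auto simp: reachable_def ex_relation)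

lemma normal_form_typed:
  assumes "reachable x y" "b \<longrightarrow> x = obX \<and> y \<noteq> obX"
  shows "normal_form x y b \<in> Mor ex_A" "src ex_A (normal_form x y b) = x"
    "tgt ex_A (normal_form x y b) = y" "flag (normal_form x y b) = b"
  using assms path_typed[of x y] path_typed[of obL y]
  by (auto simp: normal_form_def reachable_def)

text \<open>At most one of \<open>b\<close> and \<open>c\<close> holds, since they put opposite
  conditions on \<open>y\<close>. If \<open>y = obX\<close>, the first factor is an identity and
  \<open>c\<close> decides; otherwise the second factor is a path and leaves \<open>b\<close>
  unchanged.\<close>

lemma normal_form_comp:
  assumes "reachable x y" "reachable y z" "b \<longrightarrow> x = obX \<and> y \<noteq> obX" "c \<longrightarrow> y = obX \<and> z \<noteq> obX"
  shows "normal_form y z c \<odot>\<^bsub>ex_A\<^esub> normal_form x y b = normal_form x z (c \<or> b)"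
proof (cases "x = obX")
  case True
  show ?thesis
  proof (cases "y = obX")
    case True
    with \<open>x = obX\<close> assms normal_form_typed[OF assms(2,4)] show ?thesis
      by (simp add: normal_form_def)
  next
    case False
    with assms have y: "reachable obL y" "reachable obL z" "z \<noteq> obX"
      by (auto simp: reachable_def)
    with False True assms path_typed[OF y(1)] path_typed[OF assms(2)]
    show ?thesis
      by (simp add: normal_form_def ex_A.comp1_assoc path_comp)
  qed
next
  case False
  with assms have "y \<noteq> obX" by (auto simp: reachable_def)
  with False assms show ?thesis by (simp add: normal_form_def path_comp)
qed

text \<open>The two side conditions in the conclusion strengthen the induction:
  \<open>normal_form_comp\<close> needs them for a composite.\<close>

lemma mor_of_normal_form:
  assumes "wf_term ex_pres t"
  defines "x \<equiv> term_src ex_pres t" and "y \<equiv> term_tgt ex_pres t"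
  shows "reachable x y \<and> (term_flag t \<longrightarrow> x = obX \<and> y \<noteq> obX) \<and>
    mor_of ex_pres t = normal_form x y (term_flag t)"
  using assms(1) unfolding x_def y_def
proof (induction t)
  case (MId x)
  then show ?case
    by (cases x) (simp_all add: normal_form_def reachable_def ex_A_def)
next
  case (MGen e)
  have "mor_of ex_pres (MGen e) = normal_form (ex_src e) (ex_tgt e) (e = gg)"
    unfolding gen_mor_eq_mor_of[symmetric]
    by (cases e) (simp_all add: normal_form_def)
  moreover have "term_src ex_pres (MGen e) = ex_src e" "term_tgt ex_pres (MGen e) = ex_tgt e"
    by (simp_all add: ex_pres_def)
  ultimately show ?case by (cases e) (simp_all add: reachable_def)
next
  case (MComp t s)
  let ?x = "term_src ex_pres s" and ?y = "term_tgt ex_pres s" and ?z = "term_tgt ex_pres t"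
  have w: "wf_term ex_pres t" "wf_term ex_pres s" "term_src ex_pres t = ?y" using MComp by auto
  with MComp have IH: "reachable ?x ?y" "reachable ?y ?z"
    "term_flag s \<longrightarrow> ?x = obX \<and> ?y \<noteq> obX" "term_flag t \<longrightarrow> ?y = obX \<and> ?z \<noteq> obX"
    "mor_of ex_pres s = normal_form ?x ?y (term_flag s)"
    "mor_of ex_pres t = normal_form ?y ?z (term_flag t)"
    by auto
  have "mor_of ex_pres (MComp t s) = mor_of ex_pres t \<odot>\<^bsub>ex_A\<^esub> mor_of ex_pres s"
    using w by (simp add: ex_A_def)
  also have "\<dots> = normal_form ?x ?z (term_flag t \<or> term_flag s)"
    using normal_form_comp[OF IH(1-4)] by (simp add: IH)
  finally show ?case using IH(1-4) by (auto simp: reachable_def)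
qed

lemma ex_Mor_cases:
  assumes "m \<in> Mor ex_A"
  shows "reachable (src ex_A m) (tgt ex_A m)"
    and "flag m \<Longrightarrow> src ex_A m = obX \<and> tgt ex_A m \<noteq> obX"
    and "m = normal_form (src ex_A m) (tgt ex_A m) (flag m)"
proof -
  from assms obtain t where t: "m = mor_of ex_pres t" "wf_term ex_pres t"
    by (auto simp: ex_A_def Mor_presented)
  then have eqs: "src ex_A m = term_src ex_pres t" "tgt ex_A m = term_tgt ex_pres t" "flag m = term_flag t"
    by (simp_all add: ex_A_def flag_mor_of)
  show "reachable (src ex_A m) (tgt ex_A m)"
    "flag m \<Longrightarrow> src ex_A m = obX \<and> tgt ex_A m \<noteq> obX"
    "m = normal_form (src ex_A m) (tgt ex_A m) (flag m)"
    unfolding eqs using mor_of_normal_form[OF t(2)] by (simp_all add: t(1))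
qed

text \<open>The normal form mentions nothing but source, target and flag, so these three form a
  complete invariant.\<close>

lemma ex_mor_eqI:
  assumes "m \<in> Mor ex_A" "n \<in> Mor ex_A"
    and "src ex_A m = src ex_A n" "tgt ex_A m = tgt ex_A n" "flag m = flag n"
  shows "m = n"
proof -
  have "m = normal_form (src ex_A m) (tgt ex_A m) (flag m)"
    by (rule ex_Mor_cases(3)[OF assms(1)])
  also have "\<dots> = normal_form (src ex_A n) (tgt ex_A n) (flag n)"
    by (simp only: assms(3-5))
  also have "\<dots> = n"
    by (rule ex_Mor_cases(3)[OF assms(2), symmetric])
  finally show ?thesis .
qed

section \<open>The 2-morphisms of the example\<close>

definition ex_alpha :: "(ex_ob, ex_gen, ex_gen2) pcell" where
  "ex_alpha = cell_of ex_pres (CGen galpha)"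

lemma wf_galpha: "wf_cell ex_pres (CGen galpha)"
  by (simp add: ex_pres_def)

lemma ex_alpha_simps [simp]:
  "ex_alpha \<in> Cell ex_A" "dom2 ex_A ex_alpha = ex_mor gf" "cod2 ex_A ex_alpha = ex_mor gg"
  using wf_galpha
  by (simp_all add: ex_alpha_def ex_A_def Cell_presented gen_mor_eq_mor_of del: wf_cell.simps)
    (simp_all add: ex_pres_def)

text \<open>Whiskering on one side is enough, because the only morphism into \<open>obX\<close> is
  its identity.\<close>

definition is_whiskered_alpha :: "(ex_ob, ex_gen, ex_gen2) pcell \<Rightarrow> bool" where
  "is_whiskered_alpha a \<longleftrightarrow> (\<exists>n\<in>Mor ex_A. src ex_A n = obL \<and> a = id2 ex_A n \<star>\<^bsub>ex_A\<^esub> ex_alpha)"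

text \<open>The whiskering morphism starts at \<open>obL\<close>, so it carries no flag and cannot
  end at \<open>obX\<close>. The flags of the boundary are therefore those of \<open>gf\<close> and
  \<open>gg\<close>.\<close>

lemma whiskered_alpha_flag:
  assumes "is_whiskered_alpha a"
  shows "a \<in> Cell ex_A" "src ex_A (dom2 ex_A a) = obX" "tgt ex_A (dom2 ex_A a) \<noteq> obX"
    "\<not> flag (dom2 ex_A a)" "flag (cod2 ex_A a)"
proof -
  obtain n where n: "n \<in> Mor ex_A" "src ex_A n = obL" "a = id2 ex_A n \<star>\<^bsub>ex_A\<^esub> ex_alpha"
    using assms by (auto simp: is_whiskered_alpha_def)
  with ex_Mor_cases(1,2)[OF n(1)]
  show "a \<in> Cell ex_A" "src ex_A (dom2 ex_A a) = obX" "tgt ex_A (dom2 ex_A a) \<noteq> obX"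
    "\<not> flag (dom2 ex_A a)" "flag (cod2 ex_A a)"
    by (auto simp: reachable_def)
qed

lemma whiskered_alpha_eqI:
  assumes "is_whiskered_alpha a" "is_whiskered_alpha b" "tgt ex_A (dom2 ex_A a) = tgt ex_A (dom2 ex_A b)"
  shows "a = b"
proof -
  obtain n m where n: "n \<in> Mor ex_A" "src ex_A n = obL" "a = id2 ex_A n \<star>\<^bsub>ex_A\<^esub> ex_alpha"
    and m: "m \<in> Mor ex_A" "src ex_A m = obL" "b = id2 ex_A m \<star>\<^bsub>ex_A\<^esub> ex_alpha"
    using assms by (auto simp: is_whiskered_alpha_def)
  have "n = m"
    using n m assms(3) ex_Mor_cases(2)[OF n(1)] ex_Mor_cases(2)[OF m(1)]
    by (intro ex_mor_eqI) auto
  with n m show ?thesis by simp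
qed

text \<open>Identities together with whiskerings of \<open>\<alpha>\<close> are closed under both
  compositions, because two whiskerings of \<open>\<alpha>\<close> can be composed neither
  vertically nor horizontally.\<close>

lemma ex_Cell_cases:
  assumes "a \<in> Cell ex_A"
  shows "a = id2 ex_A (dom2 ex_A a) \<or> is_whiskered_alpha a"
proof -
  have "cell_of ex_pres c = id2 ex_A (dom2 ex_A (cell_of ex_pres c)) \<or>
      is_whiskered_alpha (cell_of ex_pres c)" if "wf_cell ex_pres c" for c
    using that
  proof (induction c)
    case (CId p)
    then show ?case by (simp add: ex_A_def)
  next
    case (CGen d)
    have "ex_alpha = id2 ex_A (id1 ex_A obL) \<star>\<^bsub>ex_A\<^esub> ex_alpha"
      using ex_A.hcomp_id_left[of ex_alpha] by simp
    then have "is_whiskered_alpha ex_alpha"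
      unfolding is_whiskered_alpha_def by (intro bexI[of _ "id1 ex_A obL"]) auto
    then show ?case by (cases d) (simp add: ex_alpha_def)
  next
    case (CVert d c)
    let ?c = "cell_of ex_pres c" and ?d = "cell_of ex_pres d"
    have w: "wf_cell ex_pres c" "wf_cell ex_pres d" using CVert by auto
    then have C: "?c \<in> Cell ex_A" "?d \<in> Cell ex_A" by (simp_all add: ex_A_def Cell_presented)
    have cd: "cod2 ex_A ?c = dom2 ex_A ?d"
      using CVert.prems wf_cell_CVert_iff[OF w] by (simp add: ex_A_def)
    have eq: "cell_of ex_pres (CVert d c) = ?d \<cdot>\<^bsub>ex_A\<^esub> ?c"
      using CVert.prems by (simp add: ex_A_def)
    consider "?d = id2 ex_A (dom2 ex_A ?d)" | "?c = id2 ex_A (dom2 ex_A ?c)"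
      | "is_whiskered_alpha ?c" "is_whiskered_alpha ?d"
      using CVert.IH w by blast
    then show ?case
    proof cases
      case 1
      then have "?d \<cdot>\<^bsub>ex_A\<^esub> ?c = ?c" using C cd ex_A.vcomp_id_left by metis
      with CVert.IH w eq show ?thesis by simp
    next
      case 2
      then have "?d \<cdot>\<^bsub>ex_A\<^esub> ?c = ?d" using C cd ex_A.vcomp_id_right ex_A.cell_simps(7) ex_A.cell_simps(1) by metis
      with CVert.IH w eq show ?thesis by simp
    next
      case 3
      \<comment> \<open>Impossible: the codomain of the first is flagged, the domain of the second
        is not.\<close>
      with cd show ?thesis using whiskered_alpha_flag by metis
    qed
  next
    case (CHorz d c)
    let ?c = "cell_of ex_pres c" and ?d = "cell_of ex_pres d"
    have w: "wf_cell ex_pres c" "wf_cell ex_pres d" using CHorz by auto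
    then have C: "?c \<in> Cell ex_A" "?d \<in> Cell ex_A" by (simp_all add: ex_A_def Cell_presented)
    have cd: "tgt ex_A (dom2 ex_A ?c) = src ex_A (dom2 ex_A ?d)"
      using CHorz.prems by (simp add: ex_A_def)
    have eq: "cell_of ex_pres (CHorz d c) = ?d \<star>\<^bsub>ex_A\<^esub> ?c"
      using CHorz.prems by (simp add: ex_A_def)
    consider "?d = id2 ex_A (dom2 ex_A ?d)" "?c = id2 ex_A (dom2 ex_A ?c)"
      | "?d = id2 ex_A (dom2 ex_A ?d)" "is_whiskered_alpha ?c"
      | "is_whiskered_alpha ?d"
      using CHorz.IH w by blast
    then show ?case
    proof cases
      case 1
      then have "?d \<star>\<^bsub>ex_A\<^esub> ?c = id2 ex_A (dom2 ex_A ?d \<odot>\<^bsub>ex_A\<^esub> dom2 ex_A ?c)"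
        using C cd ex_A.hcomp_id2 ex_A.cell_simps(1) by metis
      then show ?thesis using eq C cd by simp
    next
      case 2
      then obtain n where n: "n \<in> Mor ex_A" "src ex_A n = obL" "?c = id2 ex_A n \<star>\<^bsub>ex_A\<^esub> ex_alpha"
        by (auto simp: is_whiskered_alpha_def)
      let ?m = "dom2 ex_A ?d"
      have m: "?m \<in> Mor ex_A" "tgt ex_A n = src ex_A ?m" using C cd n by simp_all
      have "?d \<star>\<^bsub>ex_A\<^esub> ?c = id2 ex_A ?m \<star>\<^bsub>ex_A\<^esub> (id2 ex_A n \<star>\<^bsub>ex_A\<^esub> ex_alpha)"
        using 2 n by metis
      also have "\<dots> = id2 ex_A (?m \<odot>\<^bsub>ex_A\<^esub> n) \<star>\<^bsub>ex_A\<^esub> ex_alpha"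
        using n m by (simp add: ex_A.hcomp_assoc)
      finally show ?thesis
        using n m eq unfolding is_whiskered_alpha_def by (intro disjI2 bexI[of _ "?m \<odot>\<^bsub>ex_A\<^esub> n"]) simp_all
    next
      case 3
      \<comment> \<open>A whiskered \<open>\<alpha>\<close> starts at \<open>obX\<close>, so
        \<open>?c\<close> ends there. By reachability it also starts there and is the identity on
        \<open>id1 ex_A obX\<close>, hence a unit for horizontal composition.\<close>
      then have tX: "tgt ex_A (dom2 ex_A ?c) = obX" using cd whiskered_alpha_flag by metis
      then have c: "?c = id2 ex_A (dom2 ex_A ?c)" using CHorz.IH w whiskered_alpha_flag by metis
      have "reachable (src ex_A (dom2 ex_A ?c)) obX" "\<not> flag (dom2 ex_A ?c)"
        using ex_Mor_cases(1,2)[of "dom2 ex_A ?c"] C tX by auto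
      then have "dom2 ex_A ?c = id1 ex_A obX"
        using C tX by (intro ex_mor_eqI) (auto simp: reachable_def)
      then have "?d \<star>\<^bsub>ex_A\<^esub> ?c = ?d"
        using c C cd tX ex_A.hcomp_id_right by metis
      with 3 eq show ?thesis by simp
    qed
  qed
  moreover obtain c where "a = cell_of ex_pres c" "wf_cell ex_pres c"
    using assms by (auto simp: ex_A_def Cell_presented)
  ultimately show ?thesis by blast
qed

text \<open>Identities keep the flag and whiskerings of \<open>\<alpha>\<close> raise it. Applied in
  both directions, this monotonicity gives antisymmetry.\<close>

lemma ex_Cell_flag:
  assumes "a \<in> Cell ex_A" "flag (dom2 ex_A a)"
  shows "flag (cod2 ex_A a)"
  using ex_Cell_cases[OF assms(1)] whiskered_alpha_flag(5) assms ex_A.cell_simps(1,7) by metis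

interpretation ex_A: posetal_two_category ex_A
proof
  fix a b
  assume ab: "a \<in> Cell ex_A" "b \<in> Cell ex_A"
  {
    assume eq: "dom2 ex_A a = dom2 ex_A b" "cod2 ex_A a = cod2 ex_A b"
    \<comment> \<open>Flags agree across an identity and differ across a whiskered
      \<open>\<alpha>\<close>, so two parallel 2-morphisms fall into the same case.\<close>
    have "flag (dom2 ex_A c) \<noteq> flag (cod2 ex_A c)" if "is_whiskered_alpha c" for c
      using whiskered_alpha_flag[OF that] by simp
    moreover have "dom2 ex_A c = cod2 ex_A c" if "c \<in> Cell ex_A" "c = id2 ex_A (dom2 ex_A c)" for c
      using that ex_A.cell_simps(1,7) by metis
    ultimately show "a = b"
      using ex_Cell_cases[OF ab(1)] ex_Cell_cases[OF ab(2)] eq ab whiskered_alpha_eqI by metis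
  }
  assume "dom2 ex_A b = cod2 ex_A a" "cod2 ex_A b = dom2 ex_A a"
  then show "dom2 ex_A a = cod2 ex_A a"
    using ab ex_Cell_flag[OF ab(1)] ex_Cell_flag[OF ab(2)] by (intro ex_mor_eqI) auto
qed

section \<open>The diagram and its cone\<close>

lemma ex_I_simps [simp]:
  "Ob ex_I = UNIV" "Mor ex_I = UNIV" "Cell ex_I = UNIV" "src ex_I = shape_dom" "tgt ex_I = shape_cod"
  "dom2 ex_I u = u" "cod2 ex_I u = u" "id1 ex_I = Ident" "comp1 ex_I = shape_comp"
  "id2 ex_I u = u" "vcomp ex_I v u = u" "hcomp ex_I = shape_comp"
  by (simp_all add: locally_discrete_def pullback_shape_def)

lemma shape_comp_Ident [simp]: "shape_comp u (Ident (shape_dom u)) = u"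
  by (cases u) simp_all

lemma shape_comp_dom_cod [simp]:
  assumes "shape_cod u = shape_dom v"
  shows "shape_dom (shape_comp v u) = shape_dom u" "shape_cod (shape_comp v u) = shape_cod v"
  using assms by (cases v; cases u; simp)+

lemma shape_comp_assoc:
  "\<lbrakk>shape_cod u = shape_dom v; shape_cod v = shape_dom w\<rbrakk> \<Longrightarrow>
     shape_comp w (shape_comp v u) = shape_comp (shape_comp w v) u"
  by (cases w; cases v; cases u; simp)

interpretation ex_I: two_category ex_I
  by unfold_locales (simp_all add: shape_comp_assoc)

interpretation ex: posetal_diagrams ex_I ex_A ..

lemma ex_F_simps [simp]:
  "fob ex_F = ex_F_ob" "fmor ex_F = ex_F_mor" "fcell ex_F u = id2 ex_A (ex_F_mor u)"
  by (simp_all add: ex_F_def)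

lemma ex_F_mor_typed [simp]:
  "ex_F_mor u \<in> Mor ex_A" "src ex_A (ex_F_mor u) = ex_F_ob (shape_dom u)"
  "tgt ex_A (ex_F_mor u) = ex_F_ob (shape_cod u)"
  by (cases u; simp)+

lemma ex_F_mor_comp:
  "shape_cod u = shape_dom v \<Longrightarrow> ex_F_mor (shape_comp v u) = ex_F_mor v \<odot>\<^bsub>ex_A\<^esub> ex_F_mor u"
  by (cases v; cases u; simp)

interpretation ex_F: two_functor ex_I ex_A ex_F
  by unfold_locales (simp_all add: ex_F_mor_comp)

lemma ex_cone_simps [simp]:
  "psrc ex_cone = const_ob ex_I ex_A obL" "ptgt ex_cone = ex_F" "pob ex_cone = ex_cone_ob"
  "pmor ex_cone u = id2 ex_A (ex_cone_ob (shape_cod u))"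
  by (simp_all add: ex_cone_def)

lemma ex_cone_ob_typed [simp]:
  "ex_cone_ob i \<in> Mor ex_A" "src ex_A (ex_cone_ob i) = obL" "tgt ex_A (ex_cone_ob i) = ex_F_ob i"
  by (cases i; simp)+

lemma ex_cone_ob_not_flag [simp]: "\<not> flag (ex_cone_ob i)"
  by (cases i) simp_all

lemma ex_cone_strict: "ex_F_mor u \<odot>\<^bsub>ex_A\<^esub> ex_cone_ob (shape_dom u) = ex_cone_ob (shape_cod u)"
  by (cases u) (simp_all add: ex_relation)

lemma pseudo_cone_ex_cone: "pseudo_cone ex_I ex_A ex_F obL ex_cone"
proof -
  have "pseudo_nat ex_I ex_A ex_cone"
    by (rule ex.strict_pseudo_natI)
      (simp_all add: ex.two_functor_const_ob ex_F.two_functor_axioms ex_cone_strict)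
  then show ?thesis by (simp add: pseudo_cone_def)
qed

section \<open>The universal property of the cone\<close>

lemma ex_cone_factor:
  assumes "pseudo_cone ex_I ex_A ex_F X \<mu>"
  shows "\<exists>f\<in>Mor ex_A. src ex_A f = X \<and> tgt ex_A f = obL \<and>
    (\<forall>i. pob \<mu> i = ex_cone_ob i \<odot>\<^bsub>ex_A\<^esub> f)"
proof -
  have \<mu>: "pseudo_nat ex_I ex_A \<mu>" "psrc \<mu> = const_ob ex_I ex_A X" "ptgt \<mu> = ex_F"
    using assms by (simp_all add: pseudo_cone_def)
  have ob [simp]: "pob \<mu> i \<in> Mor ex_A" "src ex_A (pob \<mu> i) = X" "tgt ex_A (pob \<mu> i) = ex_F_ob i" for i
    using pseudo_nat.ob[OF \<mu>(1), of i] by (simp_all add: \<mu>)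
  have strict: "ex_F_mor u \<odot>\<^bsub>ex_A\<^esub> pob \<mu> (shape_dom u) = pob \<mu> (shape_cod u)" for u
    using ex.pseudo_nat_strict(1)[OF \<mu>(1), of u] by (simp add: \<mu>)
  have Corner: "pob \<mu> Corner = ex_mor gb \<odot>\<^bsub>ex_A\<^esub> pob \<mu> Left"
    "pob \<mu> Corner = ex_mor gc \<odot>\<^bsub>ex_A\<^esub> pob \<mu> Right"
    using strict[of FromLeft] strict[of FromRight] by simp_all
  \<comment> \<open>The corner component arises from either leg by composing with an unflagged
    generator, so all three components share one flag.\<close>
  then have flag: "flag (pob \<mu> i) = flag (pob \<mu> Left)" for i
    using flag_simps(3)[of "pob \<mu> Left" "ex_mor gb"] flag_simps(3)[of "pob \<mu> Right" "ex_mor gc"]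
    by (cases i) simp_all
  have reach: "reachable X obB" "reachable X obC" "flag (pob \<mu> Left) \<longrightarrow> X = obX"
    using ex_Mor_cases(1)[OF ob(1), of Left] ex_Mor_cases(1)[OF ob(1), of Right]
      ex_Mor_cases(2)[OF ob(1), of Left] by auto
  \<comment> \<open>Only \<open>obX\<close> and \<open>obL\<close> reach both \<open>obB\<close> and
    \<open>obC\<close>.\<close>
  then have "reachable X obL" by (auto simp: reachable_def)
  \<comment> \<open>For \<open>X = obX\<close> the common flag selects \<open>gf\<close> or
    \<open>gg\<close>; for \<open>X = obL\<close> it is false and \<open>f\<close> is the
    identity.\<close>
  define f where "f = normal_form X obL (flag (pob \<mu> Left))"
  have f: "f \<in> Mor ex_A" "src ex_A f = X" "tgt ex_A f = obL" "flag f = flag (pob \<mu> Left)"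
    using normal_form_typed[OF \<open>reachable X obL\<close>, of "flag (pob \<mu> Left)"] reach(3)
    by (simp_all add: f_def)
  then have "pob \<mu> i = ex_cone_ob i \<odot>\<^bsub>ex_A\<^esub> f" for i
    using flag[of i] by (intro ex_mor_eqI) simp_all
  with f show ?thesis by blast
qed

text \<open>Equal flags force \<open>f = g\<close>, with the identity as witness. Unequal flags
  force the source \<open>obX\<close>, so the pair is \<open>gf\<close>, \<open>gg\<close> and
  \<open>\<alpha>\<close> is the witness.\<close>

lemma ex_cell_exists:
  assumes "f \<in> Mor ex_A" "g \<in> Mor ex_A" "src ex_A f = src ex_A g" "tgt ex_A f = obL" "tgt ex_A g = obL"
    and "flag f \<longrightarrow> flag g"
  shows "\<exists>a\<in>Cell ex_A. dom2 ex_A a = f \<and> cod2 ex_A a = g"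
proof (cases "flag f = flag g")
  case True
  with assms have "f = g" by (intro ex_mor_eqI) auto
  with assms show ?thesis by (intro bexI[of _ "id2 ex_A f"]) auto
next
  case False
  with assms have "flag g" "\<not> flag f" by auto
  moreover from this have "src ex_A g = obX" using ex_Mor_cases(2) assms by blast
  ultimately have "f = ex_mor gf" "g = ex_mor gg"
    using assms by (auto intro!: ex_mor_eqI)
  then show ?thesis by (intro bexI[of _ ex_alpha]) auto
qed

lemma is_pseudo_limit_ex_cone: "is_pseudo_limit ex_I ex_A ex_F (obL, ex_cone)"
proof (rule ex.is_pseudo_limitI)
  show "pseudo_cone ex_I ex_A ex_F obL ex_cone" by (rule pseudo_cone_ex_cone)
next
  fix X \<mu> assume "pseudo_cone ex_I ex_A ex_F X \<mu>"
  from ex_cone_factor[OF this]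
  show "\<exists>f\<in>Mor ex_A. src ex_A f = X \<and> tgt ex_A f = obL \<and>
      (\<forall>i\<in>Ob ex_I. pob \<mu> i = pob ex_cone i \<odot>\<^bsub>ex_A\<^esub> f)"
    by simp
next
  fix f g assume fg: "f \<in> Mor ex_A" "g \<in> Mor ex_A" "src ex_A f = src ex_A g"
    "tgt ex_A f = obL" "tgt ex_A g = obL"
  \<comment> \<open>Legs of the cone are unflagged, so composing with a leg keeps the flag. Any
    single leg, here \<open>Left\<close>, therefore reflects equality and order.\<close>
  have flag: "flag (ex_cone_ob i \<odot>\<^bsub>ex_A\<^esub> f) = flag f" "flag (ex_cone_ob i \<odot>\<^bsub>ex_A\<^esub> g) = flag g" for i
    using fg by simp_all
  {
    assume "\<forall>i\<in>Ob ex_I. pob ex_cone i \<odot>\<^bsub>ex_A\<^esub> f = pob ex_cone i \<odot>\<^bsub>ex_A\<^esub> g"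
    then have "ex_cone_ob Left \<odot>\<^bsub>ex_A\<^esub> f = ex_cone_ob Left \<odot>\<^bsub>ex_A\<^esub> g"
      by (simp del: ex_cone_ob.simps)
    then have "flag f = flag g" using flag by metis
    with fg show "f = g" by (intro ex_mor_eqI) simp_all
  }
  assume "\<forall>i\<in>Ob ex_I. \<exists>a\<in>Cell ex_A.
      dom2 ex_A a = pob ex_cone i \<odot>\<^bsub>ex_A\<^esub> f \<and> cod2 ex_A a = pob ex_cone i \<odot>\<^bsub>ex_A\<^esub> g"
  from bspec[OF this, of Left] have "\<exists>a\<in>Cell ex_A. dom2 ex_A a = ex_cone_ob Left \<odot>\<^bsub>ex_A\<^esub> f \<and>
      cod2 ex_A a = ex_cone_ob Left \<odot>\<^bsub>ex_A\<^esub> g"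
    by (simp del: ex_cone_ob.simps)
  then obtain a where "a \<in> Cell ex_A" "dom2 ex_A a = ex_cone_ob Left \<odot>\<^bsub>ex_A\<^esub> f"
    "cod2 ex_A a = ex_cone_ob Left \<odot>\<^bsub>ex_A\<^esub> g"
    by blast
  then have "flag f \<longrightarrow> flag g" using ex_Cell_flag[of a] flag by metis
  with fg show "\<exists>a\<in>Cell ex_A. dom2 ex_A a = f \<and> cod2 ex_A a = g"
    by (rule ex_cell_exists)
qed

theorem mainTheorem13:
  shows "is_pseudo_limit ex_I ex_A ex_F (obL, ex_cone) \<and>
    \<not> two_terminal (lax_slice ex_I ex_A ex_F) (obL, ex_cone)"
proof
  show "is_pseudo_limit ex_I ex_A ex_F (obL, ex_cone)" by (rule is_pseudo_limit_ex_cone)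
  \<comment> \<open>The classes differ because their flags do, so \<open>\<alpha>\<close> is a
    2-morphism between different morphisms.\<close>
  have "ex_mor gf \<noteq> ex_mor gg" using flag_simps(2) ex_gen.distinct by metis
  then show "\<not> two_terminal (lax_slice ex_I ex_A ex_F) (obL, ex_cone)"
    by (intro ex.not_two_terminal_lax_slice[OF pseudo_cone_ex_cone, of ex_alpha]) simp_all
qed

end
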